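(* Let $n,k\geq 1$. The maps $\Theta$ and $\Theta'$ restrict to mutually inverse bijections between $\widehat{\mathcal{X}}_n(k)$ and $\widehat{\mathcal{Y}}_n(k)$. Moreover, for every $(F,S)\in\widehat{\mathcal{X}}_n(k)$, writing $S_1=S\cap\mathrm{Oint}(F)$ and $S_2=S\cap\mathrm{Si}^*(F)$, one has $\Theta(F,S)=(\Phi_{S_1}(F),S_2)$ and $\mathrm{lleaf}(\Phi_{S_1}(F))-\mathrm{si}(\Phi_{S_1}(F))=\mathrm{lleaf}(F)-\mathrm{si}(F)+|S_1|$.
   Context: Trees: all trees are ordered (plane) rooted trees; the level of a node is its distance from the root (root at level 0); a leaf is a node with no children. An even $k$-ary tree is an ordered tree in which every node on an even level has exactly $k$ children. A pruned even $k$-ary tree is obtained from an even $k$-ary tree by deleting, for every even-level node all of whose children are leaves, all those children. An increasing pruned even $k$-ary tree on a set $M$ of positive integers is a pruned even $k$-ary tree whose nodes on even levels are labeled bijectively by $M$ (odd-level nodes unlabeled) such that labels increase along every path from the root downward and, for each node, the labels of its children increase from left to right. $\mathcal{F}_n(k)$ is the set of sequences $F=(T_1,\dots,T_m)$ of such trees whose label sets partition $[n]$ and whose root labels increase left to right. A labeled node is a leaf if it has no children and internal otherwise; $\mathrm{lleaf}(F)$ is the number of labeled leaves. A singleton is a one-node tree; $\mathrm{si}(F)$ is the number of singletons, $\mathrm{Si}(F)$ the set of their labels, and $\mathrm{Si}^*(F)$ is $\mathrm{Si}(F)$ minus the label of $T_m$ if $T_m$ is a singleton (otherwise $\mathrm{Si}^*(F)=\mathrm{Si}(F)$).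 For a labeled node $v$, its grand parent is the labeled node $u$ such that a child of $u$ is the parent of $v$. A labeled non-root node is old if its label is the greatest among all grand children of its grand parent, and young otherwise; roots are neither. $\mathrm{Oint}(F)$ is the set of labels of old internal nodes of $F$, $\mathrm{Yleaf}(F)$ the set of labels of young leaves. $\Phi_x$ on a tree $T$ (for a label $x$ of node $v$): (i) if $v$ is old internal, with grand parent $u$, children $\mu_1..\mu_k$ of $u$ and children $\nu_1..\nu_k$ of $v$ (left to right), delete each $\nu_j$ and attach the subtrees rooted at children of $\nu_j$ to $\mu_j$, ordering children of $\mu_j$ increasingly; (ii) if $v$ is a young leaf, with grand parent $u$ and children $\mu_1..\mu_k$ of $u$, let $F_j$ be the subtrees of $\mu_j$ whose root labels exceed $x$; attach $k$ new unlabeled children $\nu_1..\nu_k$ to $v$ and move the subtrees in $F_j$ to $\nu_j$, ordering increasingly; (iii) otherwise $\Phi_x(T)=T$. $\Phi_S(T)$ is the composition of $\Phi_x$, $x\in S$; for a forest, $\Phi_S(F)=(\Phi_{S_1}(T_1),\dots,\Phi_{S_m}(T_m))$ with $S_i$ the elements of $S$ labeling nodes of $T_i$ (for $S\subseteq\mathrm{Oint}(F)$ or $S\subseteq\mathrm{Yleaf}(F)$). Removable leaves of $F=(T_1,\dots,T_m)$: an old leaf $u$ of $T_i$ is removable if $u$ is a grand child of the root of $T_i$ and the only leaf among the grand children of that root, the first $k-1$ children of the root of $T_i$ are leaves, and (if $i<m$) the label of $u$ is smaller than the root label of $T_{i+1}$. A young leaf $u\in T_m$ with label $x$ is removable if $u$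 is a grand child of the root of $T_m$ and the first $k-1$ children of the root of $\Phi_x(T_m)$ are leaves. $\mathrm{rleaf}(F)$ is the total number of removable old and removable young leaves. $\overline{\mathcal{F}}_n(k)$ is the set of $F\in\mathcal{F}_n(k)$ whose rightmost tree is a singleton or has the first $k-1$ children of its root being leaves; $\widehat{\mathcal{F}}_n(k)=\mathcal{F}_n(k)\setminus\overline{\mathcal{F}}_n(k)$; $\widehat{\mathcal{F}}^*_n(k)=\{F\in\widehat{\mathcal{F}}_n(k): F\text{ has no young leaves},\ \mathrm{rleaf}(F)=0\}$. $\widehat{\mathcal{X}}_n(k)=\{(F,S):F\in\widehat{\mathcal{F}}^*_n(k),\ S\subseteq\mathrm{Oint}(F)\cup\mathrm{Si}^*(F)\}$ and $\widehat{\mathcal{Y}}_n(k)=\{(F,S):F\in\widehat{\mathcal{F}}_n(k),\ \mathrm{rleaf}(F)=0,\ S\subseteq\mathrm{Si}^*(F)\}$. $\Theta(F,S)=(\Phi_{S\cap\mathrm{Oint}(F)}(F),\,S\cap\mathrm{Si}^*(F))$ for $F$ without young leaves and $S\subseteq\mathrm{Oint}(F)\cup\mathrm{Si}^*(F)$; $\Theta'(F,S_1)=(\Phi_{\mathrm{Yleaf}(F)}(F),\,S_1\cup\mathrm{Yleaf}(F))$ for $S_1\subseteq\mathrm{Si}^*(F)$. *)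

theory Defs
  imports Main
begin

text \<open>
  Plane rooted trees whose even-level nodes carry labels. A term \<open>Node a [\<mu>\<^sub>1, \<dots>, \<mu>\<^sub>r]\<close> is an
  even-level node with label \<open>a\<close> and \<open>r\<close> unlabeled (odd-level) children, where each odd-level
  node \<open>\<mu>\<^sub>j\<close> is given by the list of subtrees at its children. Thus \<open>[]\<close> as an element of the
  outer list is an odd-level leaf, whereas \<open>Node a []\<close> is a labeled leaf.
\<close>

datatype tree = Node (label: nat) (children: "tree list list")

definition grand_children :: "tree \<Rightarrow> tree list" where
  "grand_children t = concat (children t)"

definition leaf :: "tree \<Rightarrow> bool" where
  "leaf t \<longleftrightarrow> children t = []"

definition internal :: "tree \<Rightarrow> bool" where
  "internal t \<longleftrightarrow> children t \<noteq> []"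

text \<open>Labeled nodes are represented by the subtrees rooted at them.\<close>

fun nodes :: "tree \<Rightarrow> tree list" where
  "nodes (Node a us) = Node a us # concat (map (\<lambda>\<mu>. concat (map nodes \<mu>)) us)"

definition labels :: "tree \<Rightarrow> nat set" where
  "labels t = label ` set (nodes t)"

definition even_kary :: "nat \<Rightarrow> tree \<Rightarrow> bool" where
  "even_kary k t \<longleftrightarrow> (\<forall>v \<in> set (nodes t). length (children v) = k)"

fun prune :: "tree \<Rightarrow> tree" where
  "prune (Node a us) =
     (if \<forall>\<mu> \<in> set us. \<mu> = [] then Node a [] else Node a (map (map prune) us))"

definition pruned_even_kary :: "nat \<Rightarrow> tree \<Rightarrow> bool" where
  "pruned_even_kary k t \<longleftrightarrow> (\<exists>t'. even_kary k t' \<and> t = prune t')"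

definition increasing_tree :: "nat \<Rightarrow> nat set \<Rightarrow> tree \<Rightarrow> bool" where
  "increasing_tree k M t \<longleftrightarrow>
     pruned_even_kary k t \<and>
     (\<forall>x \<in> M. 0 < x) \<and>
     distinct (map label (nodes t)) \<and> labels t = M \<and>
     (\<forall>u \<in> set (nodes t). \<forall>v \<in> set (grand_children u). label u < label v) \<and>
     (\<forall>u \<in> set (nodes t). \<forall>\<mu> \<in> set (children u). sorted_wrt (<) (map label \<mu>))"

definition forests :: "nat \<Rightarrow> nat \<Rightarrow> tree list set" where
  "forests n k = {F.
     (\<forall>T \<in> set F. increasing_tree k (labels T) T) \<and>
     (\<forall>i j. i < j \<and> j < length F \<longrightarrow> labels (F ! i) \<inter> labels (F ! j) = {}) \<and>
     (\<Union>T \<in> set F. labels T) = {1..n} \<and>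
     sorted_wrt (<) (map label F)}"

definition old_in :: "tree \<Rightarrow> tree \<Rightarrow> bool" where
  "old_in u v \<longleftrightarrow> v \<in> set (grand_children u) \<and> (\<forall>w \<in> set (grand_children u). label w \<le> label v)"

definition young_in :: "tree \<Rightarrow> tree \<Rightarrow> bool" where
  "young_in u v \<longleftrightarrow> v \<in> set (grand_children u) \<and> \<not> old_in u v"

definition lleaf :: "tree list \<Rightarrow> nat" where
  "lleaf F = length (filter leaf (concat (map nodes F)))"

definition si :: "tree list \<Rightarrow> nat" where
  "si F = length (filter leaf F)"

definition Si :: "tree list \<Rightarrow> nat set" where
  "Si F = {label T | T. T \<in> set F \<and> leaf T}"

definition Si_star :: "tree list \<Rightarrow> nat set" where
  "Si_star F = (if leaf (last F) then Si F - {label (last F)} else Si F)"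

definition Oint :: "tree list \<Rightarrow> nat set" where
  "Oint F = {label v | v u T. T \<in> set F \<and> u \<in> set (nodes T) \<and> old_in u v \<and> internal v}"

definition Yleaf :: "tree list \<Rightarrow> nat set" where
  "Yleaf F = {label v | v u T. T \<in> set F \<and> u \<in> set (nodes T) \<and> young_in u v \<and> leaf v}"

text \<open>
  \<open>release u v\<close> and \<open>collect u v\<close> are the results at the grand parent \<open>u\<close> of applying the
  transformation to an old internal, respectively young leaf, grand child \<open>v\<close> of \<open>u\<close>.
\<close>

definition release :: "tree \<Rightarrow> tree \<Rightarrow> tree" where
  "release u v = Node (label u)
     (map2 (\<lambda>\<mu> \<nu>. sort_key label
              (map (\<lambda>t. if label t = label v then Node (label v) [] else t) \<mu> @ \<nu>))
        (children u) (children v))"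

definition collect :: "tree \<Rightarrow> tree \<Rightarrow> tree" where
  "collect u v =
     (let v' = Node (label v)
                 (map (\<lambda>\<mu>. sort_key label (filter (\<lambda>t. label v < label t) \<mu>)) (children u))
      in Node (label u)
           (map (\<lambda>\<mu>. map (\<lambda>t. if label t = label v then v' else t)
                        (filter (\<lambda>t. label t \<le> label v) \<mu>))
              (children u)))"

fun phi :: "nat \<Rightarrow> tree \<Rightarrow> tree" where
  "phi x (Node a us) =
     (case find (\<lambda>v. label v = x) (concat us) of
        None \<Rightarrow> Node a (map (map (phi x)) us)
      | Some v \<Rightarrow>
          if old_in (Node a us) v \<and> internal v then release (Node a us) v
          else if young_in (Node a us) v \<and> leaf v then collect (Node a us) v
          else Node a us)"

text \<open>
  The maps \<open>phi x\<close> commute on the sets of labels that matter (old internal nodes or young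
  leaves of an increasing tree), so composing them in increasing order of labels is only a
  convention.
\<close>

definition Phi_tree :: "nat set \<Rightarrow> tree \<Rightarrow> tree" where
  "Phi_tree S t = fold phi (sorted_list_of_set S) t"

definition Phi :: "nat set \<Rightarrow> tree list \<Rightarrow> tree list" where
  "Phi S F = map (\<lambda>T. Phi_tree (S \<inter> labels T) T) F"

definition first_children_leaves :: "nat \<Rightarrow> tree \<Rightarrow> bool" where
  "first_children_leaves k t \<longleftrightarrow>
     k - 1 \<le> length (children t) \<and> (\<forall>j < k - 1. children t ! j = [])"

definition removable_old :: "nat \<Rightarrow> tree list \<Rightarrow> nat set" where
  "removable_old k F = {label u | u i. i < length F \<and>
     old_in (F ! i) u \<and> leaf u \<and>
     (\<forall>w \<in> set (grand_children (F ! i)). leaf w \<longrightarrow> w = u) \<and>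
     first_children_leaves k (F ! i) \<and>
     (i + 1 < length F \<longrightarrow> label u < label (F ! (i + 1)))}"

definition removable_young :: "nat \<Rightarrow> tree list \<Rightarrow> nat set" where
  "removable_young k F = {label u | u.
     F \<noteq> [] \<and> young_in (last F) u \<and> leaf u \<and>
     first_children_leaves k (phi (label u) (last F))}"

definition rleaf :: "nat \<Rightarrow> tree list \<Rightarrow> nat" where
  "rleaf k F = card (removable_old k F) + card (removable_young k F)"

definition forests_bar :: "nat \<Rightarrow> nat \<Rightarrow> tree list set" where
  "forests_bar n k = {F \<in> forests n k. leaf (last F) \<or> first_children_leaves k (last F)}"

definition forests_hat :: "nat \<Rightarrow> nat \<Rightarrow> tree list set" where
  "forests_hat n k = forests n k - forests_bar n k"

definition forests_hat_star :: "nat \<Rightarrow> nat \<Rightarrow> tree list set" where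
  "forests_hat_star n k = {F \<in> forests_hat n k. Yleaf F = {} \<and> rleaf k F = 0}"

definition X_hat :: "nat \<Rightarrow> nat \<Rightarrow> (tree list \<times> nat set) set" where
  "X_hat n k = {(F, S). F \<in> forests_hat_star n k \<and> S \<subseteq> Oint F \<union> Si_star F}"

definition Y_hat :: "nat \<Rightarrow> nat \<Rightarrow> (tree list \<times> nat set) set" where
  "Y_hat n k = {(F, S). F \<in> forests_hat n k \<and> rleaf k F = 0 \<and> S \<subseteq> Si_star F}"

definition Theta :: "tree list \<times> nat set \<Rightarrow> tree list \<times> nat set" where
  "Theta = (\<lambda>(F, S). (Phi (S \<inter> Oint F) F, S \<inter> Si_star F))"

definition Theta' :: "tree list \<times> nat set \<Rightarrow> tree list \<times> nat set" where
  "Theta' = (\<lambda>(F, S). (Phi (Yleaf F) F, S \<union> Yleaf F))"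

end

theory Submission
  imports Defs "HOL-Library.Multiset"
begin

text \<open>
  An increasing pruned even \<open>k\<close>-ary tree is determined by its root label and the set of triples
  \<open>(a, j, b)\<close> saying that \<open>b\<close> is a grand child of \<open>a\<close> through the \<open>j\<close>-th child of \<open>a\<close>. On triples,
  \<open>phi x\<close> at a young leaf \<open>x\<close> with grand parent \<open>u\<close> redirects all \<open>(u, j, b)\<close> with \<open>x < b\<close> to
  \<open>(x, j, b)\<close>, and \<open>phi x\<close> at an old internal node \<open>x\<close> redirects all \<open>(x, j, b)\<close> back to \<open>(u, j, b)\<close>.
  The two operations are inverse to each other, exchange the roles of \<open>x\<close> as young leaf and old
  internal node without affecting the role of any other label, and commute for different labels.
  Being in \<open>forests_hat\<close> with \<open>rleaf = 0\<close> is a condition on the triples starting at the roots that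
  every single step preserves in both directions, and each release creates exactly one labeled leaf.
\<close>

section \<open>Sets of labeled edges\<close>

text \<open>The obstacle is that \<open>phi\<close> searches recursively, rebuilds nested lists and
  sorts them, so composites are awkward to compare on trees. Since siblings are sorted by label, the
  lists hold no information beyond the triples, and commutation and inversion become identities
  between sets. The middle component has to be kept because a moved grand child stays below the
  unlabeled child with the same index, and \<open>forests_bar\<close> and removability ask which
  indices occur. A collection at \<open>x\<close> takes away from \<open>u\<close> exactly the
  targets above \<open>x\<close>, as one block. This block keeps its order and its maximum, and
  \<open>x\<close> becomes the maximum of what stays at \<open>u\<close>; hence no other label
  changes its role. The two directions are not treated symmetrically: invariants are proved for
  collections only. A release ends in a tree where collecting at the same label leads back, so it
  inherits them. The quantity that yields the count is the number of labeled leaves plus the number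
  of old internal nodes, which one step leaves constant.\<close>

type_synonym edge_set = "(nat \<times> nat \<times> nat) set"

definition arborescent :: "edge_set \<Rightarrow> bool" where
  "arborescent E \<longleftrightarrow> (\<forall>a i b. (a, i, b) \<in> E \<longrightarrow> a < b) \<and>
     (\<forall>a i b a' i'. (a, i, b) \<in> E \<longrightarrow> (a', i', b) \<in> E \<longrightarrow> a = a' \<and> i = i')"

text \<open>A number that labels no node is a sink as well, which is why leaf counts later intersect
  with \<open>labels t\<close>.\<close>

definition sink :: "edge_set \<Rightarrow> nat \<Rightarrow> bool" where
  "sink E a \<longleftrightarrow> (\<forall>j b. (a, j, b) \<notin> E)"

definition old_internals :: "edge_set \<Rightarrow> nat set" where
  "old_internals E = {x. \<not> sink E x \<and>
     (\<exists>u i. (u, i, x) \<in> E \<and> (\<forall>j y. (u, j, y) \<in> E \<longrightarrow> y \<le> x))}"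

definition young_leaves :: "edge_set \<Rightarrow> nat set" where
  "young_leaves E = {x. sink E x \<and> (\<exists>u i j y. (u, i, x) \<in> E \<and> (u, j, y) \<in> E \<and> x < y)}"

text \<open>The grand parent is quantified instead of being an argument, so that the operation
  depends on \<open>x\<close> and \<open>E\<close> alone and commutation can be stated as an
  equation. In an arborescent set the grand parent is unique, and \<open>collect_edges_iff\<close>
  gives the form with \<open>u\<close> fixed.\<close>

definition collect_edges :: "nat \<Rightarrow> edge_set \<Rightarrow> edge_set" where
  "collect_edges x E = {(a, j, b).
     if a = x then x < b \<and> (\<exists>u i. (u, i, x) \<in> E \<and> (u, j, b) \<in> E)
     else (a, j, b) \<in> E \<and> \<not> (x < b \<and> (\<exists>i. (a, i, x) \<in> E))}"

definition release_edges :: "nat \<Rightarrow> edge_set \<Rightarrow> edge_set" where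
  "release_edges x E = {(a, j, b). a \<noteq> x \<and>
     ((a, j, b) \<in> E \<or> (x, j, b) \<in> E \<and> (\<exists>i. (a, i, x) \<in> E))}"

lemma arborescentD:
  assumes "arborescent E"
  shows "(a, i, b) \<in> E \<Longrightarrow> a < b"
    and "(a, i, b) \<in> E \<Longrightarrow> (a', i', b) \<in> E \<Longrightarrow> a = a'"
    and "(a, i, b) \<in> E \<Longrightarrow> (a', i', b) \<in> E \<Longrightarrow> i = i'"
  using assms unfolding arborescent_def by blast+

lemma collect_edges_iff:
  assumes "arborescent E" "sink E x" "(u, i, x) \<in> E"
  shows "(a, j, b) \<in> collect_edges x E \<longleftrightarrow>
    (a = x \<and> x < b \<and> (u, j, b) \<in> E \<or> (a, j, b) \<in> E \<and> \<not> (a = u \<and> x < b))"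
proof -
  have "(v, l, x) \<in> E \<longleftrightarrow> v = u \<and> l = i" for v l
    using assms(3) arborescentD(2,3)[OF assms(1)] by blast
  then show ?thesis using assms(2) unfolding collect_edges_def sink_def by auto
qed

lemma release_edges_iff:
  assumes "arborescent E" "(u, i, x) \<in> E"
  shows "(a, j, b) \<in> release_edges x E \<longleftrightarrow>
    a \<noteq> x \<and> ((a, j, b) \<in> E \<or> a = u \<and> (x, j, b) \<in> E)"
  using assms arborescentD(2)[OF assms(1)] unfolding release_edges_def by auto

lemma arborescent_collect_edges:
  assumes "arborescent E" "sink E x" "(u, i, x) \<in> E"
  shows "arborescent (collect_edges x E)"
  unfolding arborescent_def collect_edges_iff[OF assms]
  by (auto dest: arborescentD[OF assms(1)])

lemma arborescent_release_edges:
  assumes "arborescent E" "(u, i, x) \<in> E"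
  shows "arborescent (release_edges x E)"
  unfolding arborescent_def release_edges_iff[OF assms]
  \<comment> \<open>A released triple \<open>(u, j, b)\<close> increases because of
    \<open>u < x < b\<close>.\<close>
  using less_trans[OF arborescentD(1)[OF assms]]
  by (auto dest: arborescentD[OF assms(1)])

section \<open>Effect of one step on the roles of labels\<close>

lemma young_leavesE:
  assumes "x \<in> young_leaves E"
  obtains u i j y where "sink E x" "(u, i, x) \<in> E" "(u, j, y) \<in> E" "x < y"
  using assms unfolding young_leaves_def by blast

lemma old_internalsE:
  assumes "x \<in> old_internals E"
  obtains u i j y where "(x, j, y) \<in> E" "(u, i, x) \<in> E" "\<And>j y. (u, j, y) \<in> E \<Longrightarrow> y \<le> x"
  using assms unfolding old_internals_def sink_def by blast

text \<open>Being young, and not merely a sink, makes \<open>x\<close> stop being a sink: the larger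
  target \<open>y\<close> moves below it. The grand parent does not become a sink because it keeps
  \<open>x\<close>.\<close>

lemma sink_collect_edges:
  assumes E: "arborescent E" and x: "x \<in> young_leaves E"
  shows "sink (collect_edges x E) a \<longleftrightarrow> sink E a \<and> a \<noteq> x"
proof -
  obtain u i j y where *: "sink E x" "(u, i, x) \<in> E" "(u, j, y) \<in> E" "x < y"
    using x by (rule young_leavesE)
  show ?thesis
    unfolding sink_def collect_edges_iff[OF E *(1,2)]
    using * by (metis less_irrefl sink_def)
qed

text \<open>A young leaf in the moved block keeps its larger companion, which moves along. One below
  \<open>x\<close> may lose its companion, but then \<open>x\<close> itself is a larger target still
  at \<open>u\<close>.\<close>

lemma young_leaves_collect_edges:
  assumes E: "arborescent E" and x: "x \<in> young_leaves E"
  shows "young_leaves (collect_edges x E) = young_leaves E - {x}"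
proof -
  obtain u i j y where *: "sink E x" "(u, i, x) \<in> E" "(u, j, y) \<in> E" "x < y"
    using x by (rule young_leavesE)
  have "(\<exists>u i j y. (u, i, z) \<in> collect_edges x E \<and> (u, j, y) \<in> collect_edges x E \<and> z < y) \<longleftrightarrow>
        (\<exists>u i j y. (u, i, z) \<in> E \<and> (u, j, y) \<in> E \<and> z < y)"
    (is "?L \<longleftrightarrow> ?R") if "z \<noteq> x" for z
  proof
    assume ?L then show ?R unfolding collect_edges_iff[OF E *(1,2)] using * by (auto simp: sink_def)
  next
    assume ?R
    then obtain v i' j' y' where v: "(v, i', z) \<in> E" "(v, j', y') \<in> E" "z < y'" by blast
    show ?L
    proof (cases "v = u")
      case True
      show ?thesis
      proof (cases "z < x")
        case True
        then show ?thesis unfolding collect_edges_iff[OF E *(1,2)]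
          using * v \<open>v = u\<close> less_irrefl less_asym by blast
      next
        case False
        then have "x < z" using that by simp
        then show ?thesis unfolding collect_edges_iff[OF E *(1,2)]
          using * v \<open>v = u\<close> less_trans by blast
      qed
    next
      case False
      then show ?thesis unfolding collect_edges_iff[OF E *(1,2)] using v by blast
    qed
  qed
  then have "z \<in> young_leaves (collect_edges x E) \<longleftrightarrow> z \<in> young_leaves E" if "z \<noteq> x" for z
    using sink_collect_edges[OF E x] that by (simp only: young_leaves_def mem_Collect_eq) simp
  moreover have "x \<notin> young_leaves (collect_edges x E)"
    unfolding young_leaves_def using sink_collect_edges[OF E x] by simp
  ultimately show ?thesis by (intro set_eqI) (metis Diff_iff insert_iff empty_iff)
qed

text \<open>After the collection \<open>x\<close> is the maximum at \<open>u\<close>, and the former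
  maximum at \<open>u\<close>, which exceeds \<open>x\<close>, becomes the maximum at
  \<open>x\<close>.\<close>

lemma old_internals_collect_edges:
  assumes E: "arborescent E" and x: "x \<in> young_leaves E"
  shows "old_internals (collect_edges x E) = insert x (old_internals E)"
proof -
  obtain u i j y where *: "sink E x" "(u, i, x) \<in> E" "(u, j, y) \<in> E" "x < y"
    using x by (rule young_leavesE)
  note C = collect_edges_iff[OF E *(1,2)]
  have u: "(u, i, x) \<in> collect_edges x E" "\<And>j y. (u, j, y) \<in> collect_edges x E \<Longrightarrow> y \<le> x"
    using * arborescentD(1)[OF E *(2)] unfolding C by auto
  then have xo: "x \<in> old_internals (collect_edges x E)"
    unfolding old_internals_def using sink_collect_edges[OF E x] by blast
  have "(\<exists>u i. (u, i, z) \<in> collect_edges x E \<and> (\<forall>j y. (u, j, y) \<in> collect_edges x E \<longrightarrow> y \<le> z)) \<longleftrightarrow>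
        (\<exists>u i. (u, i, z) \<in> E \<and> (\<forall>j y. (u, j, y) \<in> E \<longrightarrow> y \<le> z))"
    (is "?L \<longleftrightarrow> ?R") if "z \<noteq> x" for z
  proof
    assume ?L
    then obtain v i' where v: "(v, i', z) \<in> collect_edges x E"
      "\<And>j y. (v, j, y) \<in> collect_edges x E \<Longrightarrow> y \<le> z" by blast
    show ?R
    proof (cases "v = x")
      case True
      then show ?thesis using v * unfolding C sink_def
        by (metis less_imp_le linorder_not_less order_trans)
    next
      case False
      \<comment> \<open>The greatest target left at \<open>u\<close> is \<open>x\<close>, so a
        maximum other than \<open>x\<close> cannot sit there.\<close>
      have "v \<noteq> u" 
      proof
        assume "v = u"
        then have "(v, i, x) \<in> collect_edges x E" "z \<le> x" using v(1) * C False by auto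
        then show False using v(2) that by fastforce
      qed
      then show ?thesis using v False unfolding C by blast
    qed
  next
    assume ?R
    then obtain v i' where v: "(v, i', z) \<in> E" "\<And>j y. (v, j, y) \<in> E \<Longrightarrow> y \<le> z" by blast
    show ?L
    proof (cases "v = u")
      case True
      then have "x < z" using v(2) * by fastforce
      then show ?thesis unfolding C using v True * unfolding sink_def by blast
    next
      case False
      then show ?thesis unfolding C using v * unfolding sink_def by blast
    qed
  qed
  then have "z \<in> old_internals (collect_edges x E) \<longleftrightarrow> z \<in> old_internals E" if "z \<noteq> x" for z
    using sink_collect_edges[OF E x] that by (simp only: old_internals_def mem_Collect_eq) simp
  with xo show ?thesis by (intro set_eqI) (metis insert_iff)
qed

lemma release_collect_edges:
  assumes E: "arborescent E" and x: "x \<in> young_leaves E"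
  shows "release_edges x (collect_edges x E) = E"
proof -
  obtain u i j y where *: "sink E x" "(u, i, x) \<in> E" "(u, j, y) \<in> E" "x < y"
    using x by (rule young_leavesE)
  note C = collect_edges_iff[OF E *(1,2)]
  have u: "(u, i, x) \<in> collect_edges x E" "u \<noteq> x" using * C arborescentD(1)[OF E *(2)] by auto
  have "(a, j, b) \<in> release_edges x (collect_edges x E) \<longleftrightarrow> (a, j, b) \<in> E" for a j b
    using u *(1) unfolding release_edges_iff[OF arborescent_collect_edges[OF E *(1,2)] u(1)] C sink_def by auto
  then show ?thesis by auto
qed

text \<open>Maximality of \<open>x\<close> at \<open>u\<close> makes the release reversible: targets
  already at \<open>u\<close> are at most \<open>x\<close>, released ones exceed it, so comparison
  with \<open>x\<close> separates them again. As \<open>x\<close> has an outgoing triple, some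
  released target makes it young.\<close>

lemma old_internals_release_edges:
  assumes E: "arborescent E" and x: "x \<in> old_internals E"
  shows "arborescent (release_edges x E)" "x \<in> young_leaves (release_edges x E)"
    "collect_edges x (release_edges x E) = E"
proof -
  obtain u i j y where *: "(x, j, y) \<in> E" "(u, i, x) \<in> E" "\<And>j y. (u, j, y) \<in> E \<Longrightarrow> y \<le> x"
    using x by (rule old_internalsE) blast
  note R = release_edges_iff[OF E *(2)]
  show ar: "arborescent (release_edges x E)" by (rule arborescent_release_edges[OF E *(2)])
  have u: "(u, i, x) \<in> release_edges x E" "u \<noteq> x" "sink (release_edges x E) x"
    using * R arborescentD(1)[OF E *(2)] by (auto simp: sink_def)
  moreover have "(u, j, y) \<in> release_edges x E" "x < y"
    using u(2) *(1) R arborescentD(1)[OF E *(1)] by auto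
  ultimately show "x \<in> young_leaves (release_edges x E)"
    unfolding young_leaves_def by blast
  have "(a, j, b) \<in> collect_edges x (release_edges x E) \<longleftrightarrow> (a, j, b) \<in> E" for a j b
    unfolding collect_edges_iff[OF ar u(3,1)] R
    using u(2) *(3)[of j b] arborescentD(1)[OF E, of x j b] by auto
  then show "collect_edges x (release_edges x E) = E" by auto
qed

lemma collect_edges_commute:
  assumes E: "arborescent E" and x: "x \<in> young_leaves E" and y: "y \<in> young_leaves E"
  shows "collect_edges x (collect_edges y E) = collect_edges y (collect_edges x E)"
proof -
  have "collect_edges x (collect_edges y E) = collect_edges y (collect_edges x E)"
    if x: "x \<in> young_leaves E" and y: "y \<in> young_leaves E" and less: "x < y" for x y
  proof -
    obtain u i where u: "sink E x" "(u, i, x) \<in> E" using x by (rule young_leavesE)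
    obtain v i' where v: "sink E y" "(v, i', y) \<in> E" using y by (rule young_leavesE)
    note Cx = collect_edges_iff[OF E u]
    note Cy = collect_edges_iff[OF E v]
    note ax = arborescent_collect_edges[OF E u]
    note ay = arborescent_collect_edges[OF E v]
    have sx: "sink (collect_edges y E) x" using sink_collect_edges[OF E y] u(1) less by simp
    have sy: "sink (collect_edges x E) y" using sink_collect_edges[OF E x] v(1) less by simp
    have ux: "(u, i, x) \<in> collect_edges y E" using less u by (auto simp: Cy)
    show ?thesis
    proof (cases "u = v")
      case True
      \<comment> \<open>With a common grand parent, collecting at the smaller \<open>x\<close> first
        moves \<open>y\<close> below \<open>x\<close>. In either order the targets up to
        \<open>x\<close> stay at \<open>u\<close>, those above \<open>x\<close> and up to
        \<open>y\<close> end at \<open>x\<close>, and those above \<open>y\<close> end at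
        \<open>y\<close>.\<close>
      have vy: "(x, i', y) \<in> collect_edges x E" using True less v by (auto simp: Cx)
      have "(a, j, b) \<in> collect_edges x (collect_edges y E) \<longleftrightarrow>
            (a, j, b) \<in> collect_edges y (collect_edges x E)" for a j b
        unfolding collect_edges_iff[OF ay sx ux] collect_edges_iff[OF ax sy vy] Cx Cy
        using True less arborescentD(1)[OF E] u v unfolding sink_def by (auto 0 3)
      then show ?thesis by auto
    next
      case False
      have vy: "(v, i', y) \<in> collect_edges x E" using False v by (auto simp: Cx)
      have "(a, j, b) \<in> collect_edges x (collect_edges y E) \<longleftrightarrow>
            (a, j, b) \<in> collect_edges y (collect_edges x E)" for a j b
        unfolding collect_edges_iff[OF ay sx ux] collect_edges_iff[OF ax sy vy] Cx Cy
        using False less u v unfolding sink_def by (auto 0 3)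
      then show ?thesis by auto
    qed
  qed
  then show ?thesis using x y by (metis linorder_neqE)
qed

text \<open>
  \<open>removable_root k E r u\<close> says that \<open>u\<close> is a removable old leaf of the tree with root \<open>r\<close>, apart
  from the comparison with the next root. \<open>hat_root k E r\<close> says that the last tree neither lies in
  \<open>forests_bar\<close> nor has a removable young leaf: one witness below all young leaves at \<open>r\<close>
  serves every one of them.
\<close>

definition removable_root :: "nat \<Rightarrow> edge_set \<Rightarrow> nat \<Rightarrow> nat \<Rightarrow> bool" where
  "removable_root k E r u \<longleftrightarrow> (\<exists>i. (r, i, u) \<in> E) \<and> sink E u \<and>
     (\<forall>j b. (r, j, b) \<in> E \<longrightarrow> b \<le> u \<and> (sink E b \<longrightarrow> b = u) \<and> k - 1 \<le> j)"

definition hat_root :: "nat \<Rightarrow> edge_set \<Rightarrow> nat \<Rightarrow> bool" where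
  "hat_root k E r \<longleftrightarrow> (\<exists>j b. (r, j, b) \<in> E \<and> j < k - 1 \<and>
     (\<forall>u i. (r, i, u) \<in> E \<and> u \<in> young_leaves E \<longrightarrow> b \<le> u))"

text \<open>If \<open>r\<close> is the grand parent of \<open>x\<close>, both sides fail: before the
  step the sink \<open>x\<close> is not the greatest target, after it the greatest target is
  \<open>x\<close>, which is no sink. Otherwise the triples at \<open>r\<close> and the sinks among
  their targets stay the same.\<close>

lemma removable_root_collect_edges:
  assumes E: "arborescent E" and x: "x \<in> young_leaves E" and r: "r \<noteq> x"
  shows "removable_root k (collect_edges x E) r z \<longleftrightarrow> removable_root k E r z"
proof -
  obtain u i j y where *: "sink E x" "(u, i, x) \<in> E" "(u, j, y) \<in> E" "x < y"
    using x by (rule young_leavesE)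
  note C = collect_edges_iff[OF E *(1,2)]
  note S = sink_collect_edges[OF E x]
  show ?thesis
  proof (cases "u = r")
    case True
    have "\<not> removable_root k E r z"
      using * True unfolding removable_root_def by (metis linorder_not_less)
    moreover have "\<not> removable_root k (collect_edges x E) r z"
      unfolding removable_root_def S C using True r *
      by (metis le_antisym linorder_not_less less_irrefl)
    ultimately show ?thesis by simp
  next
    case False
    then have "(r, j, b) \<in> collect_edges x E \<longleftrightarrow> (r, j, b) \<in> E" for j b
      using r by (auto simp: C)
    moreover have "b \<noteq> x" if "(r, j, b) \<in> E" for j b
      using False that arborescentD(2)[OF E] *(2) by blast
    ultimately show ?thesis unfolding removable_root_def S by blast
  qed
qed

text \<open>Let \<open>x\<close> hang below \<open>r\<close>. A witness \<open>b\<close> for the old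
  set satisfies \<open>b \<le> x\<close> because \<open>x\<close> is a young leaf, so its triple
  stays at \<open>r\<close>. A witness for the new set also has \<open>b \<le> x\<close>, hence lies
  below every young leaf from \<open>x\<close> upwards too.\<close>

lemma hat_root_collect_edges:
  assumes E: "arborescent E" and x: "x \<in> young_leaves E" and r: "r \<noteq> x"
  shows "hat_root k (collect_edges x E) r \<longleftrightarrow> hat_root k E r"
proof -
  obtain u i j y where *: "sink E x" "(u, i, x) \<in> E" "(u, j, y) \<in> E" "x < y"
    using x by (rule young_leavesE)
  note C = collect_edges_iff[OF E *(1,2)]
  note Y = young_leaves_collect_edges[OF E x]
  show ?thesis
  proof (cases "u = r")
    case True
    have C': "(r, j, b) \<in> collect_edges x E \<longleftrightarrow> (r, j, b) \<in> E \<and> b \<le> x" for j b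
      using True r C by auto
    show ?thesis
    proof
      assume "hat_root k (collect_edges x E) r"
      then obtain j b where b: "(r, j, b) \<in> E" "b \<le> x" "j < k - 1"
        "\<And>w i. (r, i, w) \<in> E \<Longrightarrow> w \<le> x \<Longrightarrow> w \<in> young_leaves E - {x} \<Longrightarrow> b \<le> w"
        unfolding hat_root_def C' Y by auto
      have "b \<le> w" if "(r, l, w) \<in> E" "w \<in> young_leaves E" for l w
        using b(2) b(4)[OF that(1)] that(2) by (cases "w < x") auto
      then show "hat_root k E r" unfolding hat_root_def using b(1,3) by blast
    next
      assume "hat_root k E r"
      then show "hat_root k (collect_edges x E) r"
        unfolding hat_root_def C' Y using True *(2) x by blast
    qed
  next
    case False
    then have "(r, j, b) \<in> collect_edges x E \<longleftrightarrow> (r, j, b) \<in> E" for j b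
      using r by (auto simp: C)
    moreover have "b \<noteq> x" if "(r, j, b) \<in> E" for j b
      using False that arborescentD(2)[OF E] *(2) by blast
    ultimately show ?thesis unfolding hat_root_def Y by blast
  qed
qed

section \<open>Increasing trees and their edges\<close>

lemma nodes_Node: "nodes (Node a us) = Node a us # concat (map nodes (concat us))"
proof -
  have "concat (map (\<lambda>\<mu>. concat (map nodes \<mu>)) us) = concat (map nodes (concat us))"
    by (induction us) auto
  then show ?thesis by simp
qed

declare nodes.simps [simp del]

text \<open>Most statements ignore which unlabeled child a subtree hangs from, so the two nested
  lists of the datatype are flattened in the induction hypothesis.\<close>

lemma tree_induct [case_names Node]:
  assumes "\<And>a us. (\<And>w. w \<in> set (concat us) \<Longrightarrow> P w) \<Longrightarrow> P (Node a us)"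
  shows "P t"
proof (induction t)
  case (Node a us)
  then show ?case using assms by force
qed

lemma set_nodes_Node:
  "set (nodes (Node a us)) = insert (Node a us) (\<Union>w\<in>set (concat us). set (nodes w))"
  by (simp add: nodes_Node)

lemma self_in_nodes [simp]: "t \<in> set (nodes t)"
  by (cases t) (simp add: nodes_Node)

lemma labels_Node: "labels (Node a us) = insert a (\<Union>w\<in>set (concat us). labels w)"
  by (auto simp: labels_def set_nodes_Node)

lemma label_in_labels [simp]: "label t \<in> labels t"
  by (simp add: labels_def)

text \<open>A step only rearranges subtrees. Equality of these multisets records this and carries
  both the label set and the distinctness of labels over to the result.\<close>

definition label_mset :: "tree \<Rightarrow> nat multiset" where
  "label_mset t = mset (map label (nodes t))"

lemma label_mset_Node:
  "label_mset (Node a us) = add_mset a (\<Sum>w\<in>#mset (concat us). label_mset w)"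
proof -
  have "mset (map label (concat (map nodes ws))) = (\<Sum>w\<in>#mset ws. label_mset w)" for ws
    by (induction ws) (auto simp: label_mset_def)
  then show ?thesis by (simp add: label_mset_def nodes_Node)
qed

lemma set_label_mset: "set_mset (label_mset t) = labels t"
  by (simp add: label_mset_def labels_def)

text \<open>The conditions on an increasing pruned tree, other than distinct and positive labels, in
  a form that mentions one node at a time; after a step only the rebuilt nodes need
  checking.\<close>

definition locally_increasing :: "nat \<Rightarrow> tree \<Rightarrow> bool" where
  "locally_increasing k u \<longleftrightarrow>
     (children u = [] \<or> length (children u) = k \<and> grand_children u \<noteq> []) \<and>
     (\<forall>v \<in> set (grand_children u). label u < label v) \<and>
     (\<forall>\<mu> \<in> set (children u). sorted_wrt (<) (map label \<mu>))"

definition increasing_pruned :: "nat \<Rightarrow> tree \<Rightarrow> bool" where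
  "increasing_pruned k t \<longleftrightarrow> distinct (map label (nodes t)) \<and> (\<forall>u \<in> set (nodes t). locally_increasing k u)"

lemma set_nodes_prune: "set (nodes (prune t)) \<subseteq> prune ` set (nodes t)"
proof (induction t rule: tree_induct)
  case (Node a us)
  have "set (nodes (prune w)) \<subseteq> prune ` (\<Union>w\<in>set (concat us). set (nodes w))"
    if "w \<in> set (concat us)" for w using Node[OF that] that by blast
  then show ?case
    by (cases "\<forall>\<mu> \<in> set us. \<mu> = []") (auto simp: set_nodes_Node simp flip: map_concat)
qed

text \<open>Restores \<open>k\<close> unlabeled leaves below each labeled leaf and so provides the
  even tree whose existence \<open>pruned_even_kary\<close> demands.\<close>

fun unprune :: "nat \<Rightarrow> tree \<Rightarrow> tree" where
  "unprune k (Node a us) =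
     Node a (if us = [] then replicate k [] else map (map (unprune k)) us)"

lemma set_nodes_unprune: "set (nodes (unprune k t)) \<subseteq> unprune k ` set (nodes t)"
proof (induction t rule: tree_induct)
  case (Node a us)
  have "set (nodes (unprune k w)) \<subseteq> unprune k ` (\<Union>w\<in>set (concat us). set (nodes w))"
    if "w \<in> set (concat us)" for w using Node[OF that] that by blast
  then show ?case by (cases "us = []") (auto simp: set_nodes_Node simp flip: map_concat)
qed

lemma prune_unprune:
  assumes "\<And>u. u \<in> set (nodes t) \<Longrightarrow> children u = [] \<or> grand_children u \<noteq> []"
  shows "prune (unprune k t) = t"
  using assms
proof (induction t rule: tree_induct)
  case (Node a us)
  have IH: "prune (unprune k w) = w" if "\<mu> \<in> set us" "w \<in> set \<mu>" for \<mu> w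
    using that Node by (auto simp: set_nodes_Node)
  have "us = [] \<or> (\<exists>\<mu>\<in>set us. \<mu> \<noteq> [])"
    using Node.prems[OF self_in_nodes] by (auto simp: grand_children_def)
  then show ?case using IH by (auto simp: map_idI)
qed

text \<open>A node without grand children is exactly what \<open>prune\<close> strips, so every node
  that keeps children has a grand child. Conversely, under this condition \<open>prune\<close>
  removes only what \<open>unprune\<close> has added.\<close>

lemma pruned_even_kary_iff:
  "pruned_even_kary k t \<longleftrightarrow> (\<forall>u \<in> set (nodes t).
     children u = [] \<or> length (children u) = k \<and> grand_children u \<noteq> [])" (is "_ \<longleftrightarrow> ?R")
proof
  assume "pruned_even_kary k t"
  then obtain t' where t': "even_kary k t'" "t = prune t'" by (auto simp: pruned_even_kary_def)
  have "children (prune u) = [] \<or> length (children (prune u)) = k \<and> grand_children (prune u) \<noteq> []"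
    if "length (children u) = k" for u
    using that by (cases u) (auto simp: grand_children_def)
  then show ?R using t' set_nodes_prune[of t'] by (fastforce simp: even_kary_def)
next
  assume R: ?R
  have "length (children (unprune k u)) = k" if "u \<in> set (nodes t)" for u
    using R that by (cases u) fastforce
  then have "even_kary k (unprune k t)"
    using set_nodes_unprune[of k t] by (auto simp: even_kary_def)
  then show "pruned_even_kary k t"
    unfolding pruned_even_kary_def using prune_unprune[of t k] R by metis
qed

lemma increasing_tree_iff:
  "increasing_tree k (labels t) t \<longleftrightarrow> increasing_pruned k t \<and> (\<forall>x \<in> labels t. 0 < x)"
  unfolding increasing_tree_def increasing_pruned_def locally_increasing_def pruned_even_kary_iff by auto

section \<open>Triples of a tree, and the tree recovered from them\<close>

definition top_edges :: "nat \<Rightarrow> tree list list \<Rightarrow> edge_set" where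
  "top_edges a us = {(a, j, label v) | j v. j < length us \<and> v \<in> set (us ! j)}"

definition edges :: "tree \<Rightarrow> edge_set" where
  "edges t = (\<Union>u\<in>set (nodes t). top_edges (label u) (children u))"

lemma edges_Node: "edges (Node a us) = top_edges a us \<union> (\<Union>w\<in>set (concat us). edges w)"
  unfolding edges_def set_nodes_Node by simp

text \<open>All of this rests on the duplicate-free list of labels: a label inside the subtree of a
  grand child identifies that grand child, and a grand child occurs below only one unlabeled
  child.\<close>

lemma increasing_pruned_Node:
  assumes "increasing_pruned k (Node a us)"
  shows "locally_increasing k (Node a us)"
    and "w \<in> set (concat us) \<Longrightarrow> increasing_pruned k w"
    and "w \<in> set (concat us) \<Longrightarrow> a \<notin> labels w"
    and "w \<in> set (concat us) \<Longrightarrow> w' \<in> set (concat us) \<Longrightarrow> x \<in> labels w \<Longrightarrow> x \<in> labels w' \<Longrightarrow> w = w'"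
    and "distinct (map label (concat us))"
    and "w \<in> set (us ! i) \<Longrightarrow> w \<in> set (us ! j) \<Longrightarrow> i < length us \<Longrightarrow> j < length us \<Longrightarrow> i = j"
proof -
  have dist: "distinct (map label (nodes w))" "set (map label (nodes w)) = labels w"
    if "w \<in> set ws" "distinct (map label (concat (map nodes ws)))" for w ws
    using that by (induction ws) (auto simp: labels_def)
  have disj: "w = w'"
    if "w \<in> set ws" "w' \<in> set ws" "x \<in> labels w" "x \<in> labels w'"
       "distinct (map label (concat (map nodes ws)))" for w w' x ws
    using that by (induction ws) (auto simp: labels_def)
  have lab: "distinct (map label ws)"
    if "distinct (map label (concat (map nodes ws)))" for ws
    using that by (induction ws) (auto, metis UN_I imageI self_in_nodes disjoint_iff)
  have D: "distinct (map label (concat (map nodes (concat us))))"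
    and a: "a \<notin> label ` set (concat (map nodes (concat us)))"
    using assms by (auto simp: increasing_pruned_def nodes_Node)
  show "locally_increasing k (Node a us)" using assms by (simp add: increasing_pruned_def)
  show "increasing_pruned k w" if "w \<in> set (concat us)"
    using dist(1)[OF that D] that assms by (fastforce simp: increasing_pruned_def set_nodes_Node)
  show "a \<notin> labels w" if "w \<in> set (concat us)"
    using a that by (auto simp: labels_def)
  show "w = w'" if "w \<in> set (concat us)" "w' \<in> set (concat us)" "x \<in> labels w" "x \<in> labels w'"
    using disj[OF that D] .
  show L: "distinct (map label (concat us))" by (rule lab[OF D])
  have "distinct (concat us)" using L by (simp add: distinct_map)
  then show "w \<in> set (us ! i) \<Longrightarrow> w \<in> set (us ! j) \<Longrightarrow> i < length us \<Longrightarrow> j < length us \<Longrightarrow> i = j"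
  proof (induction us arbitrary: i j)
    case (Cons \<mu> us)
    then show ?case by (cases i; cases j) (auto, (metis UN_I disjoint_iff nth_mem)+)
  qed simp
qed

lemma in_concat_if_nth: "j < length us \<Longrightarrow> v \<in> set (us ! j) \<Longrightarrow> v \<in> set (concat us)"
  by (auto dest: nth_mem)

lemma in_concatE:
  assumes "v \<in> set (concat us)"
  obtains j where "j < length us" "v \<in> set (us ! j)"
  using assms by (metis UN_E in_set_conv_nth set_concat)

declare set_concat [simp del]

lemma edges_labels:
  assumes "increasing_pruned k t" "(a, j, b) \<in> edges t" shows "a \<in> labels t" "b \<in> labels t" "b \<noteq> label t"
proof -
  have "a \<in> labels t \<and> b \<in> labels t \<and> b \<noteq> label t" using assms
  proof (induction t rule: tree_induct)
    case (Node c us)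
    note g = increasing_pruned_Node[OF Node.prems(1)]
    consider "(a, j, b) \<in> top_edges c us" | w where "w \<in> set (concat us)" "(a, j, b) \<in> edges w"
      using Node.prems(2) by (auto simp: edges_Node)
    then show ?case
    proof cases
      case 1
      then obtain v where v: "a = c" "b = label v" "v \<in> set (concat us)"
        by (auto simp: top_edges_def dest!: in_concat_if_nth)
      then have "b \<noteq> c" using g(3)[OF v(3)] label_in_labels[of v] by metis
      moreover have "b \<in> (\<Union>w\<in>set (concat us). labels w)" using v(2,3) label_in_labels by blast
      ultimately show ?thesis using v by (simp add: labels_Node)
    next
      case 2
      then have "a \<in> labels w" "b \<in> labels w" using Node.IH[of w] g(2)[of w] by auto
      then show ?thesis using g(3)[of w] 2(1) by (auto simp: labels_Node)
    qed
  qed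
  then show "a \<in> labels t" "b \<in> labels t" "b \<noteq> label t" by auto
qed

lemma nodes_label_inj:
  "increasing_pruned k t \<Longrightarrow> u \<in> set (nodes t) \<Longrightarrow> v \<in> set (nodes t) \<Longrightarrow> label u = label v \<Longrightarrow> u = v"
  unfolding increasing_pruned_def distinct_map by (auto dest: inj_onD)

lemma grand_children_in_nodes:
  "u \<in> set (nodes t) \<Longrightarrow> v \<in> set (grand_children u) \<Longrightarrow> v \<in> set (nodes t)"
proof (induction t rule: tree_induct)
  case (Node a us)
  consider "u = Node a us" | w where "w \<in> set (concat us)" "u \<in> set (nodes w)"
    using Node.prems(1) by (auto simp: set_nodes_Node)
  then show ?case
  proof cases
    case 1
    then have "v \<in> set (concat us)" using Node.prems(2) by (simp add: grand_children_def)
    then show ?thesis unfolding set_nodes_Node using self_in_nodes by blast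
  next
    case 2
    then show ?thesis unfolding set_nodes_Node using Node by blast
  qed
qed

lemma edges_from_node:
  assumes "increasing_pruned k t" "u \<in> set (nodes t)"
  shows "(label u, j, b) \<in> edges t \<longleftrightarrow> j < length (children u) \<and> b \<in> label ` set (children u ! j)"
  using assms nodes_label_inj[OF assms(1)] unfolding edges_def top_edges_def by auto

lemma edges_from_node_ex:
  assumes "increasing_pruned k t" "u \<in> set (nodes t)"
  shows "(\<exists>j. (label u, j, b) \<in> edges t) \<longleftrightarrow> b \<in> label ` set (grand_children u)"
  unfolding edges_from_node[OF assms] grand_children_def
  by (auto elim!: in_concatE dest: in_concat_if_nth)

lemma edgesE:
  assumes "(a, j, b) \<in> edges t"
  obtains u v where "u \<in> set (nodes t)" "v \<in> set (nodes t)" "v \<in> set (grand_children u)"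
    "a = label u" "b = label v"
proof -
  obtain u v where u: "u \<in> set (nodes t)" "v \<in> set (grand_children u)" "a = label u" "b = label v"
    using assms unfolding edges_def top_edges_def grand_children_def
    by (auto dest: in_concat_if_nth)
  then show thesis using that grand_children_in_nodes by blast
qed

text \<open>Pruning enters here: a node with unlabeled children has at least one grand child, so it
  cannot go without outgoing triples.\<close>

lemma sink_edges:
  assumes "increasing_pruned k t" "u \<in> set (nodes t)"
  shows "sink (edges t) (label u) \<longleftrightarrow> leaf u"
proof -
  have "sink (edges t) (label u) \<longleftrightarrow> (\<forall>b. b \<notin> label ` set (grand_children u))"
    unfolding sink_def edges_from_node_ex[OF assms, symmetric] by blast
  also have "\<dots> \<longleftrightarrow> grand_children u = []" by (auto simp: set_empty[symmetric] simp del: set_empty)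
  also have "\<dots> \<longleftrightarrow> leaf u"
    using assms by (auto simp: increasing_pruned_def locally_increasing_def leaf_def grand_children_def)
  finally show ?thesis .
qed

lemma arborescent_edges:
  assumes "increasing_pruned k t" shows "arborescent (edges t)"
proof -
  have "a < b" if "(a, i, b) \<in> edges t" for a i b
    using that assms by (elim edgesE) (auto simp: increasing_pruned_def locally_increasing_def)
  moreover have "a = a' \<and> i = i'" if "(a, i, b) \<in> edges t" "(a', i', b) \<in> edges t" for a i b a' i'
    using that assms
  proof (induction t rule: tree_induct)
    case (Node c us)
    note g = increasing_pruned_Node[OF Node.prems(3)]
    have sub: "\<exists>w\<in>set (concat us). b \<in> labels w \<and> b \<noteq> label w \<and> (a, i, b) \<in> edges w"
      if "(a, i, b) \<in> edges (Node c us)" "(a, i, b) \<notin> top_edges c us" for a i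
      using that edges_labels g(2) unfolding edges_Node by blast
    have top: "\<exists>w\<in>set (us ! i). a = c \<and> i < length us \<and> w \<in> set (concat us) \<and> b = label w"
      if "(a, i, b) \<in> top_edges c us" for a i
      using that unfolding top_edges_def by (auto dest: in_concat_if_nth)
    \<comment> \<open>A label cannot be the root label of one grand child and a non-root label in a
      subtree at this level, so the two kinds of triples ending in \<open>b\<close> never
      meet.\<close>
    have excl: False
      if "w \<in> set (concat us)" "b \<in> labels w" "b \<noteq> label w" "w' \<in> set (concat us)" "b = label w'" for w w'
      using g(4)[OF that(1,4,2)] that(3,5) by auto
    show ?case
    proof (cases "(a, i, b) \<in> top_edges c us")
      case T: True
      show ?thesis
      proof (cases "(a', i', b) \<in> top_edges c us")
        case True
        obtain w w' where w: "w \<in> set (us ! i)" "a = c" "i < length us" "w \<in> set (concat us)" "b = label w"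
          "w' \<in> set (us ! i')" "a' = c" "i' < length us" "w' \<in> set (concat us)" "b = label w'"
          using top[OF T] top[OF True] by blast
        have "w = w'" using g(5) w unfolding distinct_map by (auto dest: inj_onD)
        then show ?thesis using g(6) w by blast
      next
        case False
        then show ?thesis using top[OF T] sub[OF Node.prems(2)] excl by blast
      qed
    next
      case F: False
      show ?thesis
      proof (cases "(a', i', b) \<in> top_edges c us")
        case True
        then show ?thesis using top[OF True] sub[OF Node.prems(1) F] excl by blast
      next
        case False
        obtain w w' where w: "w \<in> set (concat us)" "b \<in> labels w" "(a, i, b) \<in> edges w"
          "w' \<in> set (concat us)" "b \<in> labels w'" "(a', i', b) \<in> edges w'"
          using sub[OF Node.prems(1) F] sub[OF Node.prems(2) False] by blast
        have "w = w'" using g(4) w by blast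
        then show ?thesis using Node.IH[of w] g(2) w by blast
      qed
    qed
  qed
  ultimately show ?thesis unfolding arborescent_def by blast
qed

text \<open>Nodes with equal labels are shown equal by induction: the triples give the label set
  below each position, sortedness turns it into a list, and the induction hypothesis applies
  entrywise. The root label is a separate hypothesis because a singleton has no triples.\<close>

lemma increasing_pruned_eqI:
  assumes t: "increasing_pruned k t" and t': "increasing_pruned k t'" and r: "label t = label t'" and E: "edges t = edges t'"
  shows "t = t'"
proof -
  have "u = u'" if "u \<in> set (nodes t)" "u' \<in> set (nodes t')" "label u = label u'" for u u'
    using that
  proof (induction u arbitrary: u' rule: tree_induct)
    case (Node a us)
    obtain us' where u': "u' = Node a us'" using Node.prems(3) by (cases u') auto
    have ok: "locally_increasing k (Node a us)" "locally_increasing k (Node a us')"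
      using t t' Node.prems(1,2) u' by (auto simp: increasing_pruned_def)
    have out: "(j < length us \<and> b \<in> label ` set (us ! j)) \<longleftrightarrow>
        (j < length us' \<and> b \<in> label ` set (us' ! j))" for j b
      using edges_from_node[OF t Node.prems(1), of j b] edges_from_node[OF t' Node.prems(2), of j b] E u'
      by auto
    \<comment> \<open>Triples do not show trailing empty children. The number of children is 0 or
      \<open>k\<close>, and being a leaf decides which.\<close>
    have "leaf (Node a us) \<longleftrightarrow> leaf u'"
      using sink_edges[OF t Node.prems(1)] sink_edges[OF t' Node.prems(2)] E u' by auto
    then have len: "length us = length us'" using ok u' by (auto simp: locally_increasing_def leaf_def)
    have "us ! j = us' ! j" if j: "j < length us" for j
    proof -
      have "label ` set (us ! j) = label ` set (us' ! j)" 
        using out[of j] j len by (intro set_eqI) simp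
      then have L: "map label (us ! j) = map label (us' ! j)"
        using ok j len by (intro strict_sorted_equal) (auto simp: locally_increasing_def)
      have "us ! j ! l = us' ! j ! l" if l: "l < length (us ! j)" for l
      proof (rule Node.IH)
        have l': "l < length (us' ! j)" using l L by (metis length_map)
        show 1: "us ! j ! l \<in> set (concat us)" using j l by (auto intro: in_concat_if_nth)
        show "us ! j ! l \<in> set (nodes t)"
          using grand_children_in_nodes[OF Node.prems(1)] 1 by (simp add: grand_children_def)
        have "us' ! j ! l \<in> set (concat us')" using j l' len by (auto intro: in_concat_if_nth)
        then show "us' ! j ! l \<in> set (nodes t')"
          using grand_children_in_nodes[OF Node.prems(2)] by (simp add: grand_children_def u')
        show "label (us ! j ! l) = label (us' ! j ! l)" using L l l' by (metis nth_map)
      qed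
      then show ?thesis using L by (metis length_map nth_equalityI)
    qed
    then show ?case using len u' by (auto intro: nth_equalityI)
  qed
  then show ?thesis using r self_in_nodes by blast
qed

text \<open>The one-tree forest \<open>[t]\<close> serves as the version of \<open>Oint\<close> for
  a tree; the forest version is the union over its trees.\<close>

lemma Oint_tree:
  assumes "increasing_pruned k t" shows "Oint [t] = old_internals (edges t)"
proof (intro set_eqI iffI)
  fix x assume "x \<in> Oint [t]"
  then obtain u v where u: "u \<in> set (nodes t)" "x = label v" "v \<in> set (grand_children u)" "internal v"
     "\<And>w. w \<in> set (grand_children u) \<Longrightarrow> label w \<le> label v"
    unfolding Oint_def old_in_def by auto
  have v: "v \<in> set (nodes t)" using grand_children_in_nodes u by blast
  obtain i where i: "(label u, i, label v) \<in> edges t" using edges_from_node_ex[OF assms u(1)] u(3) by blast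
  have "y \<le> x" if "(label u, j, y) \<in> edges t" for j y
    using edges_from_node_ex[OF assms u(1), of y] that u(2,5) by auto
  moreover have "\<not> sink (edges t) x" using sink_edges[OF assms v] u(2,4) by (simp add: leaf_def internal_def)
  ultimately show "x \<in> old_internals (edges t)" unfolding old_internals_def using i u(2) by blast
next
  fix x assume x: "x \<in> old_internals (edges t)"
  obtain c i j y where *: "(x, j, y) \<in> edges t" "(c, i, x) \<in> edges t" "\<And>j y. (c, j, y) \<in> edges t \<Longrightarrow> y \<le> x"
    using x by (rule old_internalsE) blast
  obtain u v where u: "u \<in> set (nodes t)" "v \<in> set (nodes t)" "v \<in> set (grand_children u)" "c = label u" "x = label v"
    using *(2) by (rule edgesE)
  have "internal v" using sink_edges[OF assms u(2)] *(1) u(5) by (auto simp: sink_def leaf_def internal_def)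
  moreover have "label w \<le> label v" if "w \<in> set (grand_children u)" for w
    using edges_from_node_ex[OF assms u(1), of "label w"] that *(3) u(4,5) by blast
  ultimately show "x \<in> Oint [t]" unfolding Oint_def old_in_def using u by auto
qed

lemma Yleaf_tree:
  assumes "increasing_pruned k t" shows "Yleaf [t] = young_leaves (edges t)"
proof (intro set_eqI iffI)
  fix x assume "x \<in> Yleaf [t]"
  then obtain u v w where u: "u \<in> set (nodes t)" "x = label v" "v \<in> set (grand_children u)" "leaf v"
     "w \<in> set (grand_children u)" "label v < label w"
    unfolding Yleaf_def young_in_def old_in_def by (auto simp: not_le)
  have v: "v \<in> set (nodes t)" using grand_children_in_nodes u by blast
  obtain i where i: "(label u, i, label v) \<in> edges t" using edges_from_node_ex[OF assms u(1)] u(3) by blast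
  obtain j where j: "(label u, j, label w) \<in> edges t" using edges_from_node_ex[OF assms u(1)] u(5) by blast
  show "x \<in> young_leaves (edges t)"
    unfolding young_leaves_def using i j u(2,4,6) sink_edges[OF assms v] by blast
next
  fix x assume x: "x \<in> young_leaves (edges t)"
  obtain c i j y where *: "sink (edges t) x" "(c, i, x) \<in> edges t" "(c, j, y) \<in> edges t" "x < y"
    using x by (rule young_leavesE)
  obtain u v where u: "u \<in> set (nodes t)" "v \<in> set (nodes t)" "v \<in> set (grand_children u)" "c = label u" "x = label v"
    using *(2) by (rule edgesE)
  obtain w where w: "w \<in> set (grand_children u)" "label w = y"
    using edges_from_node_ex[OF assms u(1), of y] *(3) u(4) by blast
  have "leaf v" using sink_edges[OF assms u(2)] *(1) u(5) by simp
  moreover have "young_in u v" unfolding young_in_def old_in_def 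
    using u(3,5) w *(4) leD by blast
  ultimately show "x \<in> Yleaf [t]" unfolding Yleaf_def using u by auto
qed

section \<open>The action of phi on edges\<close>

text \<open>The role of \<open>x\<close> and the steps at \<open>x\<close> depend only on triples
  that end in \<open>x\<close>, start at \<open>x\<close>, or start at the source of a triple ending
  in \<open>x\<close>. All of these lie in \<open>E1\<close>, so the rest is carried along
  untouched. It is used with \<open>L\<close> the labels of the subtree containing
  \<open>x\<close>.\<close>

lemma edges_union:
  assumes E1: "\<And>a j b. (a, j, b) \<in> E1 \<Longrightarrow> a \<in> L"
    and E2: "\<And>a j b. (a, j, b) \<in> E2 \<Longrightarrow> a \<notin> L \<and> b \<noteq> x"
    and x: "x \<in> L"
  shows "x \<in> old_internals (E1 \<union> E2) \<longleftrightarrow> x \<in> old_internals E1"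
    and "x \<in> young_leaves (E1 \<union> E2) \<longleftrightarrow> x \<in> young_leaves E1"
    and "release_edges x (E1 \<union> E2) = release_edges x E1 \<union> E2"
    and "collect_edges x (E1 \<union> E2) = collect_edges x E1 \<union> E2"
proof -
  have L: "(a, j, b) \<in> E1 \<union> E2 \<longleftrightarrow> (a, j, b) \<in> E1" if "a \<in> L" for a j b
    using that E2 by auto
  have X: "(a, j, x) \<in> E1 \<union> E2 \<longleftrightarrow> (a, j, x) \<in> E1" for a j using E2 by auto
  have S: "sink (E1 \<union> E2) x \<longleftrightarrow> sink E1 x" unfolding sink_def using L[OF x] by simp
  show "x \<in> old_internals (E1 \<union> E2) \<longleftrightarrow> x \<in> old_internals E1"
    unfolding old_internals_def mem_Collect_eq S X using L E1 by metis
  show "x \<in> young_leaves (E1 \<union> E2) \<longleftrightarrow> x \<in> young_leaves E1"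
    unfolding young_leaves_def mem_Collect_eq S X using L E1 by metis
  have "(a, j, b) \<in> release_edges x (E1 \<union> E2) \<longleftrightarrow> (a, j, b) \<in> release_edges x E1 \<union> E2" for a j b
    unfolding release_edges_def mem_Collect_eq prod.case X L[OF x] Un_iff
    using E2[of a j b] E2[of x j b] E2[of a _ x] x by auto
  then show "release_edges x (E1 \<union> E2) = release_edges x E1 \<union> E2" by auto
  have "(a, j, b) \<in> collect_edges x (E1 \<union> E2) \<longleftrightarrow> (a, j, b) \<in> collect_edges x E1 \<union> E2" for a j b
  proof (cases "a = x")
    case True
    have "(\<exists>u i. (u, i, x) \<in> E1 \<and> (u, j, b) \<in> E1 \<union> E2) \<longleftrightarrow> (\<exists>u i. (u, i, x) \<in> E1 \<and> (u, j, b) \<in> E1)"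
      using L E1 by metis
    then show ?thesis unfolding collect_edges_def mem_Collect_eq prod.case X
      using True E2[of x j b] x by auto
  next
    case False
    then show ?thesis unfolding collect_edges_def mem_Collect_eq prod.case X
      using E1[of a _ x] E2[of a j b] x by auto
  qed
  then show "collect_edges x (E1 \<union> E2) = collect_edges x E1 \<union> E2" by auto
qed

lemma top_edges_iff:
  "(c, j, b) \<in> top_edges a us \<longleftrightarrow> c = a \<and> j < length us \<and> b \<in> label ` set (us ! j)"
  unfolding top_edges_def by auto

lemma phi_id: "x \<notin> labels t \<Longrightarrow> phi x t = t"
proof (induction t rule: tree_induct)
  case (Node a us)
  have sub: "x \<notin> labels w" if "w \<in> set (concat us)" for w
    using Node.prems that by (auto simp: labels_Node)
  then have "label w \<noteq> x" if "w \<in> set (concat us)" for w using that label_in_labels by metis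
  then have "find (\<lambda>v. label v = x) (concat us) = None" by (simp add: find_None_iff)
  moreover have "map (map (phi x)) us = us"
    using Node.IH sub by (intro map_idI) (metis UN_I set_concat)
  ultimately show ?case by simp
qed

lemma increasing_prunedI:
  assumes "increasing_pruned k t" "label_mset t' = label_mset t" "\<And>u. u \<in> set (nodes t') \<Longrightarrow> locally_increasing k u"
  shows "increasing_pruned k t'"
  using assms mset_eq_imp_distinct_iff unfolding increasing_pruned_def label_mset_def by metis

lemma sum_mset_cong:
  fixes f g :: "'a \<Rightarrow> 'b multiset"
  assumes "\<And>w. w \<in># M \<Longrightarrow> f w = g w"
  shows "(\<Sum>w\<in>#M. f w) = (\<Sum>w\<in>#M. g w)"
  using assms by (auto intro: arg_cong[where f = sum_mset] image_mset_cong)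

text \<open>The contract of one step. The target \<open>E\<close> is left open so that collections,
  releases and the lifting to larger trees share it.\<close>

definition transformed :: "nat \<Rightarrow> tree \<Rightarrow> edge_set \<Rightarrow> tree \<Rightarrow> bool" where
  "transformed k t E t' \<longleftrightarrow> increasing_pruned k t' \<and> label t' = label t \<and> label_mset t' = label_mset t \<and> edges t' = E"

definition rest_edges :: "nat \<Rightarrow> tree list list \<Rightarrow> tree \<Rightarrow> edge_set" where
  "rest_edges a us w = top_edges a us \<union> (\<Union>w'\<in>set (concat us) - {w}. edges w')"

lemma edges_eq_rest_edges:
  "w \<in> set (concat us) \<Longrightarrow> edges (Node a us) = edges w \<union> rest_edges a us w"
  unfolding edges_Node rest_edges_def by auto

lemma rest_edges_disjoint:
  assumes g: "increasing_pruned k (Node a us)" and w0: "w0 \<in> set (concat us)" "x \<in> labels w0"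
    and ntop: "\<forall>w \<in> set (concat us). label w \<noteq> x"
    and e: "(c, j, b) \<in> rest_edges a us w0"
  shows "c \<notin> labels w0 \<and> b \<noteq> x"
proof -
  note gN = increasing_pruned_Node[OF g]
  consider "(c, j, b) \<in> top_edges a us" | w where "w \<in> set (concat us)" "w \<noteq> w0" "(c, j, b) \<in> edges w"
    using e unfolding rest_edges_def by auto
  then show ?thesis
  proof cases
    case 1
    then obtain v where "c = a" "b = label v" "v \<in> set (concat us)"
      unfolding top_edges_def by (auto dest: in_concat_if_nth)
    then show ?thesis using gN(3)[OF w0(1)] ntop by auto
  next
    case 2
    then show ?thesis using edges_labels[OF gN(2)[OF 2(1)] 2(3)] gN(4)[OF 2(1) w0(1)] w0(2) by blast
  qed
qed

lemma subtree_edges: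
  assumes g: "increasing_pruned k (Node a us)" and w0: "w0 \<in> set (concat us)" "x \<in> labels w0"
    and ntop: "\<forall>w \<in> set (concat us). label w \<noteq> x"
  shows "x \<in> old_internals (edges (Node a us)) \<longleftrightarrow> x \<in> old_internals (edges w0)"
    and "x \<in> young_leaves (edges (Node a us)) \<longleftrightarrow> x \<in> young_leaves (edges w0)"
    and "release_edges x (edges (Node a us)) = release_edges x (edges w0) \<union> rest_edges a us w0"
    and "collect_edges x (edges (Node a us)) = collect_edges x (edges w0) \<union> rest_edges a us w0"
proof -
  have 1: "c \<in> labels w0" if "(c, j, b) \<in> edges w0" for c j b
    using edges_labels(1)[OF increasing_pruned_Node(2)[OF g w0(1)] that] .
  have 2: "c \<notin> labels w0 \<and> b \<noteq> x" if "(c, j, b) \<in> rest_edges a us w0" for c j b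
    using rest_edges_disjoint[OF g w0 ntop that] .
  note U = edges_union[of "edges w0" "labels w0" "rest_edges a us w0" x, OF 1 2 w0(2)]
  show "x \<in> old_internals (edges (Node a us)) \<longleftrightarrow> x \<in> old_internals (edges w0)"
    "x \<in> young_leaves (edges (Node a us)) \<longleftrightarrow> x \<in> young_leaves (edges w0)"
    "release_edges x (edges (Node a us)) = release_edges x (edges w0) \<union> rest_edges a us w0"
    "collect_edges x (edges (Node a us)) = collect_edges x (edges w0) \<union> rest_edges a us w0"
    unfolding edges_eq_rest_edges[OF w0(1)] by (rule U; assumption)+
qed

text \<open>The recursive call runs through all grand children but changes only \<open>w0\<close>,
  the one containing \<open>x\<close>. Since its root label and label multiset are kept, the
  conditions at \<open>a\<close> and the distinctness of labels survive.\<close>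

lemma phi_lift:
  assumes g: "increasing_pruned k (Node a us)" and w0: "w0 \<in> set (concat us)" and x: "x \<in> labels w0"
    and ntop: "\<forall>w \<in> set (concat us). label w \<noteq> x"
    and T: "transformed k w0 E (phi x w0)"
  shows "transformed k (Node a us) (E \<union> rest_edges a us w0) (phi x (Node a us))"
proof -
  have gw: "increasing_pruned k (phi x w0)" and lab: "label (phi x w0) = label w0"
    and ms: "label_mset (phi x w0) = label_mset w0" and E: "edges (phi x w0) = E"
    using T unfolding transformed_def by auto
  note gN = increasing_pruned_Node[OF g]
  have idw: "phi x w = w" if "w \<in> set (concat us)" "w \<noteq> w0" for w
    using phi_id gN(4)[OF that(1) w0] x that(2) by blast
  have phi: "phi x (Node a us) = Node a (map (map (phi x)) us)"
    using ntop by (simp add: find_None_iff[THEN iffD2])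
  have labw: "label (phi x w) = label w" if "w \<in> set (concat us)" for w
    using idw that lab by metis
  have msw: "label_mset (phi x w) = label_mset w" if "w \<in> set (concat us)" for w
    using idw that ms by metis
  have goodw: "increasing_pruned k (phi x w)" if "w \<in> set (concat us)" for w
    using idw that gw gN(2) by metis
  have cc: "concat (map (map (phi x)) us) = map (phi x) (concat us)" by (simp add: map_concat)
  have M: "label_mset (phi x (Node a us)) = label_mset (Node a us)"
    unfolding phi label_mset_Node cc using msw
    by (simp add: image_mset.compositionality comp_def) (rule sum_mset_cong, simp)
  have mm: "map label (map (phi x) \<mu>) = map label \<mu>" if "\<mu> \<in> set us" for \<mu>
    using labw that by (auto simp: set_concat)
  have root: "locally_increasing k (Node a (map (map (phi x)) us))"
    using gN(1) mm labw unfolding locally_increasing_def grand_children_def tree.sel cc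
    by (simp del: map_map)
  have G: "increasing_pruned k (phi x (Node a us))"
  proof (rule increasing_prunedI[OF g M])
    fix u assume "u \<in> set (nodes (phi x (Node a us)))"
    then consider "u = phi x (Node a us)" | w where "w \<in> set (concat us)" "u \<in> set (nodes (phi x w))"
      unfolding phi set_nodes_Node cc by auto
    then show "locally_increasing k u" 
    proof cases
      case 1 then show ?thesis using root phi by simp
    next
      case 2 then show ?thesis using goodw unfolding increasing_pruned_def by blast
    qed
  qed
  have top: "top_edges a (map (map (phi x)) us) = top_edges a us"
  proof -
    have "label ` set (map (map (phi x)) us ! j) = label ` set (us ! j)" if "j < length us" for j
      using mm[of "us ! j"] that by (metis image_set nth_map nth_mem)
    then have "(c, j, b) \<in> top_edges a (map (map (phi x)) us) \<longleftrightarrow> (c, j, b) \<in> top_edges a us" for c j b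
      unfolding top_edges_iff length_map by (metis (no_types))
    then show ?thesis by auto
  qed
  have "(\<Union>w\<in>set (concat us). edges (phi x w)) = E \<union> (\<Union>w\<in>set (concat us) - {w0}. edges (phi x w))"
    using w0 E by blast
  then have "edges (phi x (Node a us)) = E \<union> rest_edges a us w0"
    unfolding phi edges_Node rest_edges_def top cc using idw by auto
  then show ?thesis unfolding transformed_def using G M
    by (metis phi tree.sel(1))
qed

text \<open>Mirrors the case distinction on \<open>find\<close> in \<open>phi\<close>: the node
  labeled \<open>x\<close> is a grand child of the root, or lies strictly inside the subtree of
  one.\<close>

lemma nested_labels:
  assumes g: "increasing_pruned k (Node a us)" and x: "x \<in> labels (Node a us)" "x \<noteq> a"
  obtains v where "v \<in> set (concat us)" "label v = x" "find (\<lambda>v. label v = x) (concat us) = Some v"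
    | w0 where "w0 \<in> set (concat us)" "x \<in> labels w0" "\<forall>w \<in> set (concat us). label w \<noteq> x"
proof (cases "find (\<lambda>v. label v = x) (concat us)")
  case None
  then show thesis using that(2) x by (auto simp: find_None_iff labels_Node)
next
  case (Some v)
  then have "v \<in> set (concat us)" "label v = x" by (auto simp: find_Some_iff)
  then show thesis using that(1) Some by blast
qed

section \<open>One step carried out at the grand parent\<close>

lemma sorted_wrt_less_sort_key:
  assumes "distinct (map label xs)"
  shows "sorted_wrt (<) (map label (sort_key label xs))"
  using assms by (simp add: strict_sorted_iff distinct_map)

lemma release_correct:
  assumes g: "increasing_pruned k (Node a us)" and v: "v \<in> set (concat us)" and i: "internal v"
  shows "transformed k (Node a us) (release_edges (label v) (edges (Node a us))) (release (Node a us) v)"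
proof -
  define x where "x = label v"
  obtain vs where vs: "v = Node x vs" unfolding x_def by (cases v) auto
  define f where "f = (\<lambda>t. if label t = x then Node x [] else t)"
  define h where "h = (\<lambda>\<mu> \<nu>. sort_key label (map f \<mu> @ \<nu>))"
  define ws where "ws = map2 h us vs"
  have rel: "release (Node a us) v = Node a ws"
    unfolding release_def ws_def h_def f_def vs tree.sel ..
  note gN = increasing_pruned_Node[OF g]
  note gv = increasing_pruned_Node[OF gN(2)[OF v, unfolded vs]]
  have lenus: "length us = k" using gN(1) v by (auto simp: locally_increasing_def)
  have lenvs: "length vs = k" using gv(1) i vs by (auto simp: locally_increasing_def internal_def)
  \<comment> \<open>\<open>map2\<close> cuts off at the shorter list; both have length
    \<open>k\<close> because \<open>v\<close> is internal, so no subtree is lost.\<close>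
  have len: "length us = length vs" using lenus lenvs by simp
  have lf: "label (f w) = label w" for w unfolding f_def by simp
  have fid: "f w = w" if "w \<in> set (concat us)" "w \<noteq> v" for w
    using gN(4)[OF that(1) v, of x] that(2) unfolding f_def x_def by (auto, metis label_in_labels)
  have fv: "f v = Node x []" unfolding f_def x_def by simp
  have wsj: "ws ! j = h (us ! j) (vs ! j)" if "j < k" for j
    unfolding ws_def using that lenus lenvs by simp
  have setwsj: "set (ws ! j) = f ` set (us ! j) \<union> set (vs ! j)" if "j < k" for j
    unfolding wsj[OF that] h_def by simp
  have mc: "mset (concat ws) = image_mset f (mset (concat us)) + mset (concat vs)"
    unfolding ws_def using len by (induction us vs rule: list_induct2) (auto simp: h_def)
  have "set (concat ws) = set_mset (mset (concat ws))" by simp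
  also have "\<dots> = f ` set (concat us) \<union> set (concat vs)" unfolding mc by simp
  finally have setws: "set (concat ws) = f ` set (concat us) \<union> set (concat vs)" .
  have fset: "f ` set (concat us) = insert (Node x []) (set (concat us) - {v})"
    using fid fv v by (auto simp: image_iff) metis+
  have xv: "x < label y" if "y \<in> set (concat vs)" for y
    using gv(1) that by (auto simp: locally_increasing_def grand_children_def)
  have ax: "a < label w" if "w \<in> set (concat us)" for w
    using gN(1) that by (auto simp: locally_increasing_def grand_children_def)
  have M: "label_mset (Node a ws) = label_mset (Node a us)"
  proof -
    obtain xs ys where xy: "concat us = xs @ v # ys" using v split_list by metis
    define N where "N = mset (xs @ ys)"
    have N: "mset (concat us) = add_mset v N" unfolding N_def xy by simp
    have "distinct (concat us)" using gN(5) by (simp add: distinct_map)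
    then have "f w = w" if "w \<in># N" for w
      using fid[of w] that unfolding N_def xy by auto
    then have "image_mset f N = N" by (metis (no_types, lifting) image_mset_cong multiset.map_ident)
    then show ?thesis unfolding label_mset_Node mc N using fv
      by (simp add: label_mset_Node vs)
  qed
  have root: "locally_increasing k (Node a ws)"
  proof -
    have "sorted_wrt (<) (map label (ws ! j))" if j: "j < k" for j
    proof -
      have 1: "set (us ! j) \<subseteq> set (concat us)" "set (vs ! j) \<subseteq> set (concat vs)"
        using j lenus lenvs by (auto intro: in_concat_if_nth)
      have "distinct (map label (us ! j))" "distinct (map label (vs ! j))"
        using gN(1) gv(1) j lenus lenvs by (auto simp: locally_increasing_def strict_sorted_iff)
      \<comment> \<open>A common label would occur in the subtree \<open>v\<close> and force
        \<open>w = v\<close>, but the grand children of \<open>v\<close> have labels above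
        \<open>x\<close>.\<close>
      moreover have "label w \<noteq> label y" if "w \<in> set (us ! j)" "y \<in> set (vs ! j)" for w y
      proof
        assume eq: "label w = label y"
        have y: "y \<in> set (concat vs)" "w \<in> set (concat us)" using 1 that by auto
        then have "label w \<in> labels v" unfolding vs labels_Node eq using label_in_labels by blast
        then have "w = v" using gN(4)[OF y(2) v label_in_labels] by simp
        then show False using xv[OF y(1)] eq x_def by simp
      qed
      ultimately have "distinct (map label (map f (us ! j) @ vs ! j))"
        using lf by (auto simp: comp_def)
      then show ?thesis unfolding wsj[OF j] h_def by (rule sorted_wrt_less_sort_key)
    qed
    moreover have lenws: "length ws = k" unfolding ws_def using lenus lenvs by simp
    moreover have "a < label y" if "y \<in> set (concat ws)" for y
    proof -
      have "y \<in> f ` set (concat us) \<or> y \<in> set (concat vs)" using that setws by blast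
      then show ?thesis using ax lf xv ax[OF v] x_def by force
    qed
    moreover have "concat ws \<noteq> []" using setws v by (metis Un_empty image_is_empty empty_iff set_empty)
    ultimately show ?thesis unfolding locally_increasing_def grand_children_def by (auto simp: in_set_conv_nth)
  qed
  have G: "increasing_pruned k (Node a ws)"
  proof (rule increasing_prunedI[OF g M])
    fix u assume "u \<in> set (nodes (Node a ws))"
    then consider "u = Node a ws" | "u = Node x []" | w where "w \<in> set (concat us)" "u \<in> set (nodes w)"
      | y where "y \<in> set (concat vs)" "u \<in> set (nodes y)"
      unfolding set_nodes_Node[of a ws] setws fset by (auto simp: nodes_Node)
    then show "locally_increasing k u"
    proof cases
      case 1 then show ?thesis using root by simp
    next
      case 2 then show ?thesis by (simp add: locally_increasing_def grand_children_def)
    next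
      case 3 then show ?thesis using gN(2) unfolding increasing_pruned_def by blast
    next
      case 4 then show ?thesis using gv(2) unfolding increasing_pruned_def by blast
    qed
  qed
  \<comment> \<open>The triples inside subtrees that are kept or moved as a whole, common to both
    edge sets. None starts at \<open>x\<close>, so the comparison reduces to the top edges.\<close>
  define R where "R = (\<Union>w\<in>set (concat us) - {v}. edges w) \<union> (\<Union>y\<in>set (concat vs). edges y)"
  have E: "edges (Node a us) = top_edges a us \<union> top_edges x vs \<union> R"
    unfolding edges_Node[of a] R_def using v edges_Node[of x vs] vs by auto
  have E': "edges (Node a ws) = top_edges a ws \<union> R"
    unfolding edges_Node[of a] R_def setws fset by (auto simp: edges_Node[of x] top_edges_def)
  have Rx: "c \<noteq> x" if "(c, j, b) \<in> R" for c j b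
  proof -
    consider w where "w \<in> set (concat us)" "w \<noteq> v" "(c, j, b) \<in> edges w"
      | y where "y \<in> set (concat vs)" "(c, j, b) \<in> edges y"
      using \<open>(c, j, b) \<in> R\<close> unfolding R_def by auto
    then show ?thesis
    proof cases
      case 1 then show ?thesis
        using edges_labels(1)[OF gN(2)[OF 1(1)] 1(3)] gN(4)[OF 1(1) v _ label_in_labels] x_def by blast
    next
      case 2 then show ?thesis
        using edges_labels(1)[OF gv(2)[OF 2(1)] 2(2)] gv(3)[OF 2(1)] by auto
    qed
  qed
  obtain l where l: "(a, l, x) \<in> edges (Node a us)"
    using v unfolding E by (elim in_concatE) (auto simp: top_edges_def x_def)
  have "a \<noteq> x" using ax[OF v] x_def by simp
  note ta = top_edges_iff
  have "(c, j, b) \<in> top_edges a ws \<longleftrightarrow> (c, j, b) \<in> top_edges a us \<or> c = a \<and> (x, j, b) \<in> top_edges x vs" for c j b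
  proof (cases "j < k")
    case True
    have "label ` set (ws ! j) = label ` set (us ! j) \<union> label ` set (vs ! j)"
      unfolding setwsj[OF True] image_Un image_image lf ..
    then show ?thesis unfolding ta using lenus lenvs True by (auto simp: ws_def)
  next
    case False
    then show ?thesis unfolding ta using lenus lenvs by (simp add: ws_def)
  qed
  moreover have "(x, j, b) \<in> edges (Node a us) \<longleftrightarrow> (x, j, b) \<in> top_edges x vs" for j b
    unfolding E using Rx \<open>a \<noteq> x\<close> by (auto simp: ta)
  ultimately have "(c, j, b) \<in> edges (Node a ws) \<longleftrightarrow> (c, j, b) \<in> release_edges x (edges (Node a us))" for c j b
    unfolding release_edges_iff[OF arborescent_edges[OF g] l] E' Un_iff
    unfolding E Un_iff using Rx[of c j b] \<open>a \<noteq> x\<close> ta[of c j b x vs] ta[of c j b a us] by auto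
  then have "edges (Node a ws) = release_edges x (edges (Node a us))" by auto
  then show ?thesis unfolding transformed_def rel x_def[symmetric] using G M by simp
qed

text \<open>The larger grand child \<open>y\<close> keeps the result pruned: it ensures that the new
  children of \<open>v\<close> are not all empty.\<close>

lemma collect_correct:
  assumes g: "increasing_pruned k (Node a us)" and v: "v \<in> set (concat us)" and lf: "leaf v"
    and y: "y \<in> set (concat us)" "label v < label y"
  shows "transformed k (Node a us) (collect_edges (label v) (edges (Node a us))) (collect (Node a us) v)"
proof -
  define x where "x = label v"
  have vs: "v = Node x []" using lf unfolding x_def leaf_def by (cases v) auto
  define vs where "vs = map (\<lambda>\<mu>. sort_key label (filter (\<lambda>t. x < label t) \<mu>)) us"
  define f where "f = (\<lambda>t. if label t = x then Node x vs else t)"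
  define ws where "ws = map (\<lambda>\<mu>. map f (filter (\<lambda>t. label t \<le> x) \<mu>)) us"
  have col: "collect (Node a us) v = Node a ws"
    unfolding collect_def ws_def f_def vs_def Let_def x_def tree.sel ..
  note gN = increasing_pruned_Node[OF g]
  have lenus: "length us = k" using gN(1) v by (auto simp: locally_increasing_def)
  have lenvs: "length vs = k" unfolding vs_def using lenus by simp
  have lenws: "length ws = k" unfolding ws_def using lenus by simp
  have labf: "label (f w) = label w" for w unfolding f_def by simp
  have fid: "f w = w" if "w \<in> set (concat us)" "w \<noteq> v" for w
    using gN(4)[OF that(1) v, of x] that(2) unfolding f_def x_def by (auto, metis label_in_labels)
  have fv: "f v = Node x vs" unfolding f_def x_def by simp
  have setwsj: "set (ws ! j) = f ` {t \<in> set (us ! j). label t \<le> x}" if "j < k" for j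
    unfolding ws_def using that lenus by simp
  have setvsj: "set (vs ! j) = {t \<in> set (us ! j). x < label t}" if "j < k" for j
    unfolding vs_def using that lenus by simp
  have mw: "mset (concat ws) = image_mset f (filter_mset (\<lambda>t. label t \<le> x) (mset (concat us)))"
    unfolding ws_def by (induction us) auto
  have mv: "mset (concat vs) = filter_mset (\<lambda>t. x < label t) (mset (concat us))"
    unfolding vs_def by (induction us) auto
  have "set (concat ws) = set_mset (mset (concat ws))" by simp
  also have "\<dots> = f ` {t \<in> set (concat us). label t \<le> x}" unfolding mw by simp
  finally have setws: "set (concat ws) = f ` {t \<in> set (concat us). label t \<le> x}" .
  have "set (concat vs) = set_mset (mset (concat vs))" by simp
  also have "\<dots> = {t \<in> set (concat us). x < label t}" unfolding mv by simp
  finally have setvs: "set (concat vs) = {t \<in> set (concat us). x < label t}" .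
  have setws': "set (concat ws) = insert (Node x vs) {t \<in> set (concat us) - {v}. label t \<le> x}"
  proof -
    have "{t \<in> set (concat us). label t \<le> x} = insert v {t \<in> set (concat us) - {v}. label t \<le> x}"
      using v x_def by auto
    moreover have "f ` {t \<in> set (concat us) - {v}. label t \<le> x} = {t \<in> set (concat us) - {v}. label t \<le> x}"
      using fid by (auto simp: image_iff)
    ultimately show ?thesis unfolding setws using fv by simp
  qed
  have ax: "a < label w" if "w \<in> set (concat us)" for w
    using gN(1) that by (auto simp: locally_increasing_def grand_children_def)
  have M: "label_mset (Node a ws) = label_mset (Node a us)"
  proof -
    obtain xs ys where xy: "concat us = xs @ v # ys" using v split_list by metis
    define N where "N = mset (xs @ ys)"
    have N: "mset (concat us) = add_mset v N" unfolding N_def xy by simp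
    have "distinct (concat us)" using gN(5) by (simp add: distinct_map)
    then have fN: "f w = w" if "w \<in># N" for w
      using fid[of w] that unfolding N_def xy by auto
    have 1: "image_mset f (filter_mset (\<lambda>t. label t \<le> x) N) = filter_mset (\<lambda>t. label t \<le> x) N"
    proof -
      have "image_mset f (filter_mset (\<lambda>t. label t \<le> x) N) = image_mset (\<lambda>t. t) (filter_mset (\<lambda>t. label t \<le> x) N)"
        by (rule image_mset_cong) (simp add: fN)
      then show ?thesis by simp
    qed
    have 2: "N = filter_mset (\<lambda>t. label t \<le> x) N + filter_mset (\<lambda>t. x < label t) N"
      using multiset_partition[of N "\<lambda>t. label t \<le> x"] by (simp add: not_le)
    have "label_mset (Node a us) = add_mset a (add_mset x (\<Sum>w\<in>#N. label_mset w))"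
      unfolding label_mset_Node N by (simp add: vs label_mset_Node)
    moreover have "(\<Sum>w\<in>#N. label_mset w) = (\<Sum>w\<in>#filter_mset (\<lambda>t. label t \<le> x) N. label_mset w)
      + (\<Sum>w\<in>#filter_mset (\<lambda>t. x < label t) N. label_mset w)"
      by (subst 2) simp
    moreover have "label_mset (Node x vs) = add_mset x (\<Sum>w\<in>#filter_mset (\<lambda>t. x < label t) N. label_mset w)"
      unfolding label_mset_Node mv N using x_def by simp
    ultimately show ?thesis unfolding label_mset_Node[of a ws] mw N
      using fv 1 x_def by simp
  qed
  have srt: "sorted_wrt (<) (map label (us ! j))" if "j < k" for j
    using gN(1) that lenus by (auto simp: locally_increasing_def)
  have root: "locally_increasing k (Node a ws)"
  proof -
    have "sorted_wrt (<) (map label (ws ! j))" if j: "j < k" for j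
      using srt[OF j] j lenus unfolding ws_def
      by (simp add: sorted_wrt_map labf sorted_wrt_filter)
    moreover have "a < label z" if "z \<in> set (concat ws)" for z
      using that ax labf unfolding setws by auto
    moreover have "concat ws \<noteq> []" using setws' by (metis insert_not_empty set_empty)
    ultimately show ?thesis using lenws unfolding locally_increasing_def grand_children_def by (auto simp: in_set_conv_nth)
  qed
  have ok_v: "locally_increasing k (Node x vs)"
  proof -
    have "sorted_wrt (<) (map label (vs ! j))" if j: "j < k" for j
    proof -
      have "distinct (map label (us ! j))" using srt[OF j] by (simp add: strict_sorted_iff)
      then have "sorted_wrt (<) (map label (sort_key label (filter (\<lambda>t. x < label t) (us ! j))))"
        by (intro sorted_wrt_less_sort_key distinct_map_filter)
      then show ?thesis unfolding vs_def using j lenus by simp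
    qed
    moreover have "concat vs \<noteq> []" using setvs y unfolding x_def by (metis (mono_tags, lifting) empty_iff mem_Collect_eq set_empty)
    ultimately show ?thesis using lenvs setvs unfolding locally_increasing_def grand_children_def by (auto simp: in_set_conv_nth)
  qed
  have G: "increasing_pruned k (Node a ws)"
  proof (rule increasing_prunedI[OF g M])
    fix u assume "u \<in> set (nodes (Node a ws))"
    then consider "u = Node a ws" | "u = Node x vs" | w where "w \<in> set (concat us)" "u \<in> set (nodes w)"
      unfolding set_nodes_Node[of a ws] setws' using set_nodes_Node[of x vs] setvs by auto
    then show "locally_increasing k u"
    proof cases
      case 1 then show ?thesis using root by simp
    next
      case 2 then show ?thesis using ok_v by simp
    next
      case 3 then show ?thesis using gN(2) unfolding increasing_pruned_def by blast
    qed
  qed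
  define R where "R = (\<Union>w\<in>set (concat us) - {v}. edges w)"
  have "edges v = {}" using vs by (simp add: edges_Node top_edges_def)
  then have E: "edges (Node a us) = top_edges a us \<union> R"
    unfolding edges_Node[of a] R_def using v by auto
  have "set (concat us) - {v} = {t \<in> set (concat us) - {v}. label t \<le> x} \<union> set (concat vs)"
    unfolding setvs x_def by auto
  then have E': "edges (Node a ws) = top_edges a ws \<union> top_edges x vs \<union> R"
    unfolding edges_Node[of a] R_def setws' using edges_Node[of x vs] by auto
  have Ra: "c \<noteq> a" if "(c, j, b) \<in> R" for c j b
  proof -
    obtain w where w: "w \<in> set (concat us)" "(c, j, b) \<in> edges w"
      using \<open>(c, j, b) \<in> R\<close> unfolding R_def by auto
    then show ?thesis using edges_labels(1)[OF gN(2)[OF w(1)] w(2)] gN(3)[OF w(1)] by auto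
  qed
  obtain l where l: "(a, l, x) \<in> edges (Node a us)"
    using v unfolding E by (elim in_concatE) (auto simp: top_edges_def x_def)
  have "v \<in> set (nodes (Node a us))" using v self_in_nodes unfolding set_nodes_Node by blast
  then have sink: "sink (edges (Node a us)) x" using sink_edges[OF g] lf x_def by blast
  have "a \<noteq> x" using ax[OF v] x_def by simp
  have Ta: "(c, j, b) \<in> top_edges a ws \<longleftrightarrow> (c, j, b) \<in> top_edges a us \<and> b \<le> x" for c j b
  proof (cases "j < k")
    case True
    have "label ` set (ws ! j) = {b \<in> label ` set (us ! j). b \<le> x}"
      unfolding setwsj[OF True] image_image labf by auto
    then show ?thesis unfolding top_edges_iff using lenus lenws True by auto
  qed (simp add: top_edges_iff lenus lenws)
  have Tx: "(c, j, b) \<in> top_edges x vs \<longleftrightarrow> c = x \<and> (a, j, b) \<in> top_edges a us \<and> x < b" for c j b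
  proof (cases "j < k")
    case True
    have "label ` set (vs ! j) = {b \<in> label ` set (us ! j). x < b}"
      unfolding setvsj[OF True] by auto
    then show ?thesis unfolding top_edges_iff using lenus lenvs True by auto
  qed (simp add: top_edges_iff lenus lenvs)
  have aE: "(a, j, b) \<in> edges (Node a us) \<longleftrightarrow> (a, j, b) \<in> top_edges a us" for j b
    unfolding E using Ra by blast
  have "(c, j, b) \<in> edges (Node a ws) \<longleftrightarrow> (c, j, b) \<in> collect_edges x (edges (Node a us))" for c j b
    unfolding collect_edges_iff[OF arborescent_edges[OF g] sink l] E' Un_iff Ta Tx aE
    unfolding E Un_iff using Ra[of c j b] \<open>a \<noteq> x\<close> top_edges_iff[of c j b a us] by (auto simp: not_less)
  then have "edges (Node a ws) = collect_edges x (edges (Node a us))" by auto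
  then show ?thesis unfolding transformed_def col x_def[symmetric] using G M by simp
qed

lemma phi_old:
  assumes "increasing_pruned k t" "x \<in> old_internals (edges t)"
  shows "transformed k t (release_edges x (edges t)) (phi x t)"
  using assms
proof (induction t rule: tree_induct)
  case (Node a us)
  note g = Node.prems(1)
  obtain c i j y where *: "(x, j, y) \<in> edges (Node a us)" "(c, i, x) \<in> edges (Node a us)"
    "\<And>j y. (c, j, y) \<in> edges (Node a us) \<Longrightarrow> y \<le> x"
    using Node.prems(2) by (rule old_internalsE) blast
  have x: "x \<in> labels (Node a us)" "x \<noteq> a" using edges_labels[OF g *(2)] by auto
  show ?case
  proof (rule nested_labels[OF g x])
    fix v assume v: "v \<in> set (concat us)" "label v = x" "find (\<lambda>v. label v = x) (concat us) = Some v"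
    have vn: "v \<in> set (nodes (Node a us))" using v self_in_nodes unfolding set_nodes_Node by blast
    have int: "internal v" using sink_edges[OF g vn] *(1) v(2) by (auto simp: sink_def leaf_def internal_def)
    have gc: "\<exists>j. (a, j, label w) \<in> edges (Node a us)" if "w \<in> set (concat us)" for w
      using edges_from_node_ex[OF g self_in_nodes, of "label w"] that by (simp add: grand_children_def)
    \<comment> \<open>Only one triple ends in \<open>x\<close>, so the node where
      \<open>find\<close> succeeds is the grand parent witnessing that \<open>x\<close> is
      old.\<close>
    then have "c = a" using arborescentD(2)[OF arborescent_edges[OF g] *(2)] v(1,2) by metis
    then have "old_in (Node a us) v" using gc *(3) v(1,2) by (fastforce simp: old_in_def grand_children_def)
    then show ?thesis using release_correct[OF g v(1) int] v int by simp
  next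
    fix w0 assume w0: "w0 \<in> set (concat us)" "x \<in> labels w0" and ntop: "\<forall>w \<in> set (concat us). label w \<noteq> x"
    note gw = increasing_pruned_Node(2)[OF g w0(1)]
    note U = subtree_edges[OF g w0 ntop]
    have "x \<in> old_internals (edges w0)" using Node.prems(2) U(1) by blast
    then have "transformed k w0 (release_edges x (edges w0)) (phi x w0)" by (rule Node.IH[OF w0(1) gw])
    then show ?thesis unfolding U(3) by (rule phi_lift[OF g w0 ntop])
  qed
qed

lemma phi_young:
  assumes "increasing_pruned k t" "x \<in> young_leaves (edges t)"
  shows "transformed k t (collect_edges x (edges t)) (phi x t)"
  using assms
proof (induction t rule: tree_induct)
  case (Node a us)
  note g = Node.prems(1)
  obtain c i j y where *: "sink (edges (Node a us)) x" "(c, i, x) \<in> edges (Node a us)"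
    "(c, j, y) \<in> edges (Node a us)" "x < y"
    using Node.prems(2) by (rule young_leavesE)
  have x: "x \<in> labels (Node a us)" "x \<noteq> a" using edges_labels[OF g *(2)] by auto
  show ?case
  proof (rule nested_labels[OF g x])
    fix v assume v: "v \<in> set (concat us)" "label v = x" "find (\<lambda>v. label v = x) (concat us) = Some v"
    have vn: "v \<in> set (nodes (Node a us))" using v self_in_nodes unfolding set_nodes_Node by blast
    have lf: "leaf v" using sink_edges[OF g vn] *(1) v(2) by simp
    have gc: "(\<exists>j. (a, j, b) \<in> edges (Node a us)) \<longleftrightarrow> b \<in> label ` set (concat us)" for b
      using edges_from_node_ex[OF g self_in_nodes, of b] by (simp add: grand_children_def)
    then obtain l where "(a, l, x) \<in> edges (Node a us)" using v(1,2) by blast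
    then have "c = a" by (rule arborescentD(2)[OF arborescent_edges[OF g] *(2)])
    then obtain w where w: "w \<in> set (concat us)" "label w = y" using gc[of y] *(3) by blast
    then have "\<not> old_in (Node a us) v" "young_in (Node a us) v"
      using v(1,2) *(4) by (auto simp: old_in_def young_in_def grand_children_def not_le)
    then show ?thesis using collect_correct[OF g v(1) lf w(1)] w(2) *(4) v lf by simp
  next
    fix w0 assume w0: "w0 \<in> set (concat us)" "x \<in> labels w0" and ntop: "\<forall>w \<in> set (concat us). label w \<noteq> x"
    note gw = increasing_pruned_Node(2)[OF g w0(1)]
    note U = subtree_edges[OF g w0 ntop]
    have "x \<in> young_leaves (edges w0)" using Node.prems(2) U(2) by blast
    then have "transformed k w0 (collect_edges x (edges w0)) (phi x w0)" by (rule Node.IH[OF w0(1) gw])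
    then show ?thesis unfolding U(4) by (rule phi_lift[OF g w0 ntop])
  qed
qed

section \<open>Composition over sets of labels\<close>

lemma lleaf_tree:
  assumes "increasing_pruned k t"
  shows "lleaf [t] = card {x \<in> labels t. sink (edges t) x}"
proof -
  have "distinct (map label (filter leaf (nodes t)))"
    using assms unfolding increasing_pruned_def by (simp add: distinct_map_filter)
  then have "length (filter leaf (nodes t)) = card (label ` set (filter leaf (nodes t)))"
    by (metis distinct_card length_map set_map)
  moreover have "label ` set (filter leaf (nodes t)) = {x \<in> labels t. sink (edges t) x}"
    using sink_edges[OF assms] unfolding labels_def by auto
  ultimately show ?thesis unfolding lleaf_def by simp
qed

lemma finite_labels [simp]: "finite (labels t)"
  by (simp add: labels_def)

lemma special_labels:
  assumes "increasing_pruned k t"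
  shows "old_internals (edges t) \<subseteq> labels t" "young_leaves (edges t) \<subseteq> labels t"
    "x \<in> old_internals (edges t) \<union> young_leaves (edges t) \<Longrightarrow> x \<noteq> label t"
    "old_internals (edges t) \<inter> young_leaves (edges t) = {}"
  by (auto elim!: old_internalsE young_leavesE simp: sink_def dest: edges_labels[OF assms])

text \<open>Everything that a step \<open>phi x\<close> at an old internal node or a young leaf leaves unchanged.\<close>

definition profile :: "nat \<Rightarrow> tree \<Rightarrow> nat \<times> nat set \<times> bool \<times> nat set \<times> bool \<times> nat set \<times> nat" where
  "profile k t = (label t, labels t, leaf t, {u. removable_root k (edges t) (label t) u},
     hat_root k (edges t) (label t), young_leaves (edges t) \<union> old_internals (edges t),
     lleaf [t] + card (old_internals (edges t)))"

lemma labels_eq_if_label_mset: "label_mset t' = label_mset t \<Longrightarrow> labels t' = labels t"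
  by (simp flip: set_label_mset)

text \<open>Afterwards \<open>x\<close> is old internal, so a second \<open>phi x\<close> acts as a
  release; equality with \<open>t\<close> is then decided on triples and root labels.\<close>

lemma phi_young_step:
  assumes t: "increasing_pruned k t" and x: "x \<in> young_leaves (edges t)"
  shows "increasing_pruned k (phi x t)" "edges (phi x t) = collect_edges x (edges t)"
    "young_leaves (edges (phi x t)) = young_leaves (edges t) - {x}"
    "x \<in> old_internals (edges (phi x t))"
    "phi x (phi x t) = t" "profile k (phi x t) = profile k t"
proof -
  define t' where "t' = phi x t"
  have t': "increasing_pruned k t'" "label t' = label t" "label_mset t' = label_mset t" "edges t' = collect_edges x (edges t)"
    using phi_young[OF t x] unfolding transformed_def t'_def by auto
  note ar = arborescent_edges[OF t]
  show "increasing_pruned k (phi x t)" "edges (phi x t) = collect_edges x (edges t)" using t' t'_def by auto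
  have y: "young_leaves (edges t') = young_leaves (edges t) - {x}"
    using young_leaves_collect_edges[OF ar x] t'(4) by simp
  then show "young_leaves (edges (phi x t)) = young_leaves (edges t) - {x}" by (simp add: t'_def)
  have o: "old_internals (edges t') = insert x (old_internals (edges t))"
    using old_internals_collect_edges[OF ar x] t'(4) by simp
  then show xo: "x \<in> old_internals (edges (phi x t))" by (simp add: t'_def)
  have "transformed k t' (release_edges x (edges t')) (phi x t')"
    by (rule phi_old[OF t'(1)]) (use o in simp)
  then have "increasing_pruned k (phi x t')" "label (phi x t') = label t" "edges (phi x t') = edges t"
    using t'(2,4) release_collect_edges[OF ar x] unfolding transformed_def by auto
  then show "phi x (phi x t) = t" using increasing_pruned_eqI t t'_def by metis
  have xr: "x \<in> labels t" "label t \<noteq> x" using special_labels[OF t] x by auto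
  have xo': "x \<notin> old_internals (edges t)" using special_labels(4)[OF t] x by auto
  note sk = sink_collect_edges[OF ar x]
  have lab: "labels t' = labels t" using t'(3) by (rule labels_eq_if_label_mset)
  have "leaf t' \<longleftrightarrow> leaf t"
    using sink_edges[OF t self_in_nodes] sink_edges[OF t'(1) self_in_nodes] t'(2,4) sk xr(2) by simp
  \<comment> \<open>The leaf lost at \<open>x\<close> is balanced by the old internal node gained
    there, which keeps the last entry of the profile constant.\<close>
  moreover have "lleaf [t] = Suc (lleaf [t'])"
  proof -
    have "{z \<in> labels t'. sink (edges t') z} = {z \<in> labels t. sink (edges t) z} - {x}"
      unfolding lab t'(4) sk by auto
    moreover have "x \<in> {z \<in> labels t. sink (edges t) z}" using x xr(1) by (auto elim: young_leavesE)
    ultimately show ?thesis unfolding lleaf_tree[OF t] lleaf_tree[OF t'(1)]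
      using card.remove[of "{z \<in> labels t. sink (edges t) z}" x] by simp
  qed
  moreover have "card (old_internals (edges t')) = Suc (card (old_internals (edges t)))"
    unfolding o using xo' finite_subset[OF special_labels(1)[OF t]] by simp
  ultimately show "profile k (phi x t) = profile k t"
    unfolding profile_def t'_def[symmetric] y o t'(2) lab
    using removable_root_collect_edges[OF ar x xr(2)] hat_root_collect_edges[OF ar x xr(2)] t'(4) x
    by auto
qed

text \<open>Obtained by applying \<open>phi_young_step\<close> to the released tree, from which
  collecting at \<open>x\<close> leads back to \<open>t\<close>.\<close>

lemma phi_old_step:
  assumes t: "increasing_pruned k t" and x: "x \<in> old_internals (edges t)"
  shows "increasing_pruned k (phi x t)" "old_internals (edges (phi x t)) = old_internals (edges t) - {x}"
    "x \<in> young_leaves (edges (phi x t))"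
    "phi x (phi x t) = t" "profile k (phi x t) = profile k t"
proof -
  define t' where "t' = phi x t"
  have t': "increasing_pruned k t'" "label t' = label t" "edges t' = release_edges x (edges t)"
    using phi_old[OF t x] unfolding transformed_def t'_def by auto
  note R = old_internals_release_edges[OF arborescent_edges[OF t] x]
  have y: "x \<in> young_leaves (edges t')" using R(2) t'(3) by simp
  have "transformed k t' (collect_edges x (edges t')) (phi x t')"
    by (rule phi_young[OF t'(1) y])
  then have "increasing_pruned k (phi x t')" "label (phi x t') = label t" "edges (phi x t') = edges t"
    using t' R(3) unfolding transformed_def by auto
  then have inv: "phi x t' = t" using increasing_pruned_eqI t by metis
  show "increasing_pruned k (phi x t)" "x \<in> young_leaves (edges (phi x t))" "phi x (phi x t) = t"
    using t'(1) y inv t'_def by auto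
  show "profile k (phi x t) = profile k t"
    using phi_young_step(6)[OF t'(1) y] inv t'_def by simp
  have "old_internals (edges t) = insert x (old_internals (edges t'))"
    using old_internals_collect_edges[OF arborescent_edges[OF t'(1)] y] R(3) t'(3) by simp
  moreover have "x \<notin> old_internals (edges t')" using special_labels(4)[OF t'(1)] y by auto
  ultimately show "old_internals (edges (phi x t)) = old_internals (edges t) - {x}"
    using t'_def by auto
qed

lemma phi_commute_young:
  assumes t: "increasing_pruned k t" and x: "x \<in> young_leaves (edges t)" and y: "y \<in> young_leaves (edges t)"
  shows "phi x (phi y t) = phi y (phi x t)"
proof (cases "x = y")
  case False
  note X = phi_young_step[OF t x] and Y = phi_young_step[OF t y]
  have y': "y \<in> young_leaves (edges (phi x t))" using X(3) y False by auto
  have x': "x \<in> young_leaves (edges (phi y t))" using Y(3) x False by auto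
  note YX = phi_young_step[OF X(1) y'] and XY = phi_young_step[OF Y(1) x']
  have "edges (phi x (phi y t)) = edges (phi y (phi x t))"
    unfolding XY(2) YX(2) X(2) Y(2) by (rule collect_edges_commute[OF arborescent_edges[OF t] x y])
  moreover have "label (phi x (phi y t)) = label (phi y (phi x t))"
    using XY(6) YX(6) X(6) Y(6) unfolding profile_def by simp
  ultimately show ?thesis using increasing_pruned_eqI XY(1) YX(1) by blast
qed simp

text \<open>Reduced to young leaves: in the tree \<open>s\<close> with both labels released,
  \<open>x\<close> and \<open>y\<close> are young leaves, so the collections leading from
  \<open>s\<close> back to \<open>t\<close> commute. Undoing them in the other order gives the
  claim.\<close>

lemma phi_commute_old:
  assumes t: "increasing_pruned k t" and x: "x \<in> old_internals (edges t)" and y: "y \<in> old_internals (edges t)"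
  shows "phi x (phi y t) = phi y (phi x t)"
proof (cases "x = y")
  case False
  note X = phi_old_step[OF t x] and Y = phi_old_step[OF t y]
  have y': "y \<in> old_internals (edges (phi x t))" using X(2) y False by auto
  note YX = phi_old_step[OF X(1) y']
  define s where "s = phi y (phi x t)"
  have s: "increasing_pruned k s" "y \<in> young_leaves (edges s)" "phi y s = phi x t" using YX unfolding s_def by auto
  have "young_leaves (edges s) - {y} = young_leaves (edges (phi x t))"
    using phi_young_step(3)[OF s(1,2)] s(3) by simp
  then have xs: "x \<in> young_leaves (edges s)" using X(3) by auto
  have "phi y (phi x s) = phi x (phi y s)" by (rule phi_commute_young[OF s(1,2) xs])
  also have "\<dots> = t" using s(3) X(4) by simp
  finally have eq: "phi y (phi x s) = t" .
  have ys: "y \<in> young_leaves (edges (phi x s))" using phi_young_step(3)[OF s(1) xs] s(2) False by auto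
  have "phi x s = phi y t" using phi_young_step(5)[OF phi_young_step(1)[OF s(1) xs] ys] eq by simp
  then have "phi x (phi y t) = s" using phi_young_step(5)[OF s(1) xs] by simp
  then show ?thesis by (simp add: s_def)
qed simp

text \<open>The second run uses the same order as the first, not the reverse. Commutation in the
  first run moves its initial \<open>x\<close> to the end, where the initial \<open>x\<close> of the
  second run cancels it; the rest is the induction hypothesis. Thus commutation is needed only while
  both labels still belong to \<open>A\<close>.\<close>

lemma fold_commuting_involutions:
  assumes step: "\<And>x t. P t \<Longrightarrow> x \<in> A t \<Longrightarrow>
      P (f x t) \<and> A (f x t) = A t - {x} \<and> f x (f x t) = t \<and> g (f x t) = g t"
    and comm: "\<And>x y t. P t \<Longrightarrow> x \<in> A t \<Longrightarrow> y \<in> A t \<Longrightarrow> f x (f y t) = f y (f x t)"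
    and "P t" "distinct xs" "set xs \<subseteq> A t"
  shows "P (fold f xs t) \<and> A (fold f xs t) = A t - set xs \<and> g (fold f xs t) = g t \<and>
    fold f xs (fold f xs t) = t"
  using assms(3-5)
proof (induction xs arbitrary: t)
  case (Cons x xs)
  have inv: "P (fold f ys s) \<and> A (fold f ys s) = A s - set ys \<and> g (fold f ys s) = g s"
    if "P s" "distinct ys" "set ys \<subseteq> A s" for ys s
    using that
  proof (induction ys arbitrary: s)
    case (Cons y ys)
    have "P (f y s)" "A (f y s) = A s - {y}" "g (f y s) = g s" using step Cons.prems by auto
    then show ?case using Cons.IH[of "f y s"] Cons.prems by auto
  qed simp
  have slide: "fold f ys (f x s) = f x (fold f ys s)"
    if "P s" "distinct ys" "set ys \<subseteq> A s" "x \<in> A s" "x \<notin> set ys" for ys s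
    using that
  proof (induction ys arbitrary: s)
    case (Cons y ys)
    have *: "P (f y s)" "A (f y s) = A s - {y}" using step Cons.prems by auto
    have "fold f ys (f y (f x s)) = fold f ys (f x (f y s))" using comm Cons.prems by simp
    also have "\<dots> = f x (fold f ys (f y s))" using Cons.IH[OF *(1)] *(2) Cons.prems by auto
    finally show ?case by simp
  qed simp
  have xs: "P t" "distinct xs" "set xs \<subseteq> A t" "x \<in> A t" "x \<notin> set xs" using Cons.prems by auto
  note I = inv[OF xs(1-3)]
  have "fold f (x # xs) t = f x (fold f xs t)" using slide[OF xs] by simp
  moreover have "x \<in> A (fold f xs t)" using I xs(4,5) by simp
  ultimately have "fold f (x # xs) (fold f (x # xs) t) = fold f xs (fold f xs t)"
    using step I by simp
  also have "\<dots> = t" using Cons.IH xs(1-3) by blast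
  finally have "fold f (x # xs) (fold f (x # xs) t) = t" .
  then show ?case using inv[OF Cons.prems] by blast
qed simp

text \<open>The two sets are disjoint and a profile fixes their union, so what leaves one must enter
  the other.\<close>

lemma profile_old_young:
  assumes "increasing_pruned k t" "increasing_pruned k t'" "profile k t' = profile k t"
  shows "young_leaves (edges t') = young_leaves (edges t) - S \<Longrightarrow> S \<subseteq> young_leaves (edges t) \<Longrightarrow>
      old_internals (edges t') = old_internals (edges t) \<union> S"
    and "old_internals (edges t') = old_internals (edges t) - S \<Longrightarrow> S \<subseteq> old_internals (edges t) \<Longrightarrow>
      young_leaves (edges t') = young_leaves (edges t) \<union> S"
proof -
  have 1: "young_leaves (edges t') \<union> old_internals (edges t') = young_leaves (edges t) \<union> old_internals (edges t)"
    using assms(3) unfolding profile_def by simp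
  note 2 = special_labels(4)[OF assms(1)] special_labels(4)[OF assms(2)]
  show "old_internals (edges t') = old_internals (edges t) \<union> S"
    if "young_leaves (edges t') = young_leaves (edges t) - S" "S \<subseteq> young_leaves (edges t)"
    using 1 2 that by blast
  show "young_leaves (edges t') = young_leaves (edges t) \<union> S"
    if "old_internals (edges t') = old_internals (edges t) - S" "S \<subseteq> old_internals (edges t)"
    using 1 2 that by blast
qed

lemma Phi_tree_young:
  assumes t: "increasing_pruned k t" and S: "S \<subseteq> Yleaf [t]"
  shows "increasing_pruned k (Phi_tree S t)" "profile k (Phi_tree S t) = profile k t"
    "Yleaf [Phi_tree S t] = Yleaf [t] - S" "Oint [Phi_tree S t] = Oint [t] \<union> S"
    "Phi_tree S (Phi_tree S t) = t"
proof -
  \<comment> \<open>\<open>sorted_list_of_set\<close> enumerates \<open>S\<close> only if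
    \<open>S\<close> is finite.\<close>
  have fin: "finite S" using S special_labels(2)[OF t] Yleaf_tree[OF t] finite_subset[OF _ finite_labels[of t], of S] by auto
  have *: "increasing_pruned k (fold phi xs t) \<and> young_leaves (edges (fold phi xs t)) = young_leaves (edges t) - set xs \<and>
      profile k (fold phi xs t) = profile k t \<and> fold phi xs (fold phi xs t) = t"
    if "distinct xs" "set xs \<subseteq> young_leaves (edges t)" for xs
    by (rule fold_commuting_involutions[where P = "increasing_pruned k" and A = "\<lambda>t. young_leaves (edges t)"
          and g = "profile k", OF _ _ t that])
      (simp_all add: phi_young_step(1,3,5,6) phi_commute_young)
  have T: "increasing_pruned k (Phi_tree S t)" "young_leaves (edges (Phi_tree S t)) = young_leaves (edges t) - S"
    "profile k (Phi_tree S t) = profile k t" "Phi_tree S (Phi_tree S t) = t"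
    using *[of "sorted_list_of_set S"] fin S Yleaf_tree[OF t] unfolding Phi_tree_def by auto
  show "increasing_pruned k (Phi_tree S t)" "profile k (Phi_tree S t) = profile k t" "Phi_tree S (Phi_tree S t) = t"
    by fact+
  show "Yleaf [Phi_tree S t] = Yleaf [t] - S" "Oint [Phi_tree S t] = Oint [t] \<union> S"
    using T profile_old_young(1)[OF t T(1,3,2)] S
    by (simp_all add: Yleaf_tree[OF t] Yleaf_tree[OF T(1)] Oint_tree[OF t] Oint_tree[OF T(1)])
qed

lemma Phi_tree_old:
  assumes t: "increasing_pruned k t" and S: "S \<subseteq> Oint [t]"
  shows "increasing_pruned k (Phi_tree S t)" "profile k (Phi_tree S t) = profile k t"
    "Oint [Phi_tree S t] = Oint [t] - S" "Yleaf [Phi_tree S t] = Yleaf [t] \<union> S"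
    "Phi_tree S (Phi_tree S t) = t"
proof -
  have fin: "finite S" using S special_labels(1)[OF t] Oint_tree[OF t] finite_subset[OF _ finite_labels[of t], of S] by auto
  have *: "increasing_pruned k (fold phi xs t) \<and> old_internals (edges (fold phi xs t)) = old_internals (edges t) - set xs \<and>
      profile k (fold phi xs t) = profile k t \<and> fold phi xs (fold phi xs t) = t"
    if "distinct xs" "set xs \<subseteq> old_internals (edges t)" for xs
    by (rule fold_commuting_involutions[where P = "increasing_pruned k" and A = "\<lambda>t. old_internals (edges t)"
          and g = "profile k", OF _ _ t that])
      (simp_all add: phi_old_step phi_commute_old)
  have T: "increasing_pruned k (Phi_tree S t)" "old_internals (edges (Phi_tree S t)) = old_internals (edges t) - S"
    "profile k (Phi_tree S t) = profile k t" "Phi_tree S (Phi_tree S t) = t"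
    using *[of "sorted_list_of_set S"] fin S Oint_tree[OF t] unfolding Phi_tree_def by auto
  show "increasing_pruned k (Phi_tree S t)" "profile k (Phi_tree S t) = profile k t" "Phi_tree S (Phi_tree S t) = t"
    by fact+
  show "Oint [Phi_tree S t] = Oint [t] - S" "Yleaf [Phi_tree S t] = Yleaf [t] \<union> S"
    using T profile_old_young(2)[OF t T(1,3,2)] S
    by (simp_all add: Yleaf_tree[OF t] Yleaf_tree[OF T(1)] Oint_tree[OF t] Oint_tree[OF T(1)])
qed

section \<open>Forests\<close>

lemma Oint_forest: "Oint F = (\<Union>T\<in>set F. Oint [T])"
  unfolding Oint_def by auto

lemma Yleaf_forest: "Yleaf F = (\<Union>T\<in>set F. Yleaf [T])"
  unfolding Yleaf_def by auto

lemma forests_increasing_pruned: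
  assumes "F \<in> forests n k" "T \<in> set F" shows "increasing_pruned k T"
  using assms unfolding forests_def increasing_tree_iff by simp

lemma forests_disjoint:
  assumes "F \<in> forests n k" "T \<in> set F" "T' \<in> set F" "x \<in> labels T" "x \<in> labels T'"
  shows "T = T'"
proof -
  obtain i j where ij: "i < length F" "j < length F" "T = F ! i" "T' = F ! j"
    using assms(2,3) by (auto simp: in_set_conv_nth)
  have "labels (F ! i) \<inter> labels (F ! j) = {}" if "i < j" "j < length F" for i j
    using that assms(1) unfolding forests_def by simp
  then have "i = j" using ij assms(4,5) by (metis IntI empty_iff linorder_neqE_nat)
  then show ?thesis using ij by simp
qed

lemma Oint_tree_labels: "increasing_pruned k T \<Longrightarrow> Oint [T] \<subseteq> labels T"
  by (simp add: Oint_tree special_labels)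

lemma Yleaf_tree_labels: "increasing_pruned k T \<Longrightarrow> Yleaf [T] \<subseteq> labels T"
  by (simp add: Yleaf_tree special_labels)

lemma subset_forest_tree:
  assumes F: "F \<in> forests n k" and T: "T \<in> set F"
    and A: "\<And>T. T \<in> set F \<Longrightarrow> A T \<subseteq> labels T" and S: "S \<subseteq> (\<Union>T\<in>set F. A T)"
  shows "S \<inter> labels T \<subseteq> A T"
proof
  fix x assume x: "x \<in> S \<inter> labels T"
  then obtain T' where T': "T' \<in> set F" "x \<in> A T'" using S by blast
  then have "T' = T" using forests_disjoint[OF F T'(1) T] A x by blast
  then show "x \<in> A T" using T' by simp
qed

lemma profileD:
  assumes "profile k t' = profile k t"
  shows "label t' = label t" "labels t' = labels t" "leaf t' = leaf t"
    "removable_root k (edges t') (label t') = removable_root k (edges t) (label t)"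
    "hat_root k (edges t') (label t') = hat_root k (edges t) (label t)"
    "lleaf [t'] + card (old_internals (edges t')) = lleaf [t] + card (old_internals (edges t))"
  using assms unfolding profile_def by (auto simp: set_eq_iff)

lemma forests_if_profile:
  assumes F: "F \<in> forests n k" and G: "\<And>T. T \<in> set G \<Longrightarrow> increasing_pruned k T"
    and p: "map (profile k) G = map (profile k) F"
  shows "G \<in> forests n k"
proof -
  have len: "length G = length F" using p by (metis length_map)
  have nth: "profile k (G ! i) = profile k (F ! i)" if "i < length F" for i
    using p that len by (metis nth_map)
  have lab: "map label G = map label F"
    using len profileD(1)[OF nth] by (intro nth_equalityI) simp_all
  have labs: "labels (G ! i) = labels (F ! i)" if "i < length F" for i
    using profileD(2)[OF nth[OF that]] .
  then have "map labels G = map labels F" using len by (intro nth_equalityI) simp_all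
  then have "labels ` set G = labels ` set F" by (metis set_map)
  then have un: "(\<Union>T\<in>set G. labels T) = {1..n}" using F unfolding forests_def by simp
  have "increasing_tree k (labels T) T" if "T \<in> set G" for T
  proof -
    \<comment> \<open>Positivity is not part of \<open>increasing_pruned\<close>; it is recovered
      from the label set of the whole forest.\<close>
    have "labels T \<subseteq> {1..n}" using un that by blast
    then show ?thesis using G[OF that] unfolding increasing_tree_iff by auto
  qed
  moreover have "labels (G ! i) \<inter> labels (G ! j) = {}" if "i < j" "j < length G" for i j
    using F that len labs[of i] labs[of j] unfolding forests_def by simp
  ultimately show ?thesis using un lab F unfolding forests_def by simp
qed

lemma Phi_forest:
  assumes F: "F \<in> forests n k" and S: "S \<subseteq> Yleaf F \<or> S \<subseteq> Oint F"
  shows "Phi S F \<in> forests n k" "map (profile k) (Phi S F) = map (profile k) F" "Phi S (Phi S F) = F"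
    "S \<subseteq> Yleaf F \<Longrightarrow> Yleaf (Phi S F) = Yleaf F - S \<and> Oint (Phi S F) = Oint F \<union> S"
    "S \<subseteq> Oint F \<Longrightarrow> Oint (Phi S F) = Oint F - S \<and> Yleaf (Phi S F) = Yleaf F \<union> S"
proof -
  let ?f = "\<lambda>T. Phi_tree (S \<inter> labels T) T"
  note good = forests_increasing_pruned[OF F]
  have YL: "Yleaf [T] \<subseteq> labels T" and OL: "Oint [T] \<subseteq> labels T" if "T \<in> set F" for T
    using Yleaf_tree_labels Oint_tree_labels good[OF that] by auto
  have y: "S \<inter> labels T \<subseteq> Yleaf [T]" if "S \<subseteq> Yleaf F" "T \<in> set F" for T
    using subset_forest_tree[OF F that(2), of "\<lambda>T. Yleaf [T]" S] Yleaf_tree_labels[OF good] that(1) Yleaf_forest[of F]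
    by blast
  have o: "S \<inter> labels T \<subseteq> Oint [T]" if "S \<subseteq> Oint F" "T \<in> set F" for T
    using subset_forest_tree[OF F that(2), of "\<lambda>T. Oint [T]" S] Oint_tree_labels[OF good] that(1) Oint_forest[of F]
    by blast
  have T: "increasing_pruned k (?f T) \<and> profile k (?f T) = profile k T \<and> Phi_tree (S \<inter> labels T) (?f T) = T"
    if "T \<in> set F" for T
    using S Phi_tree_young(1,2,5)[OF good[OF that] y] Phi_tree_old(1,2,5)[OF good[OF that] o] that by blast
  show p: "map (profile k) (Phi S F) = map (profile k) F"
    using T unfolding Phi_def by simp
  show "Phi S F \<in> forests n k"
    by (rule forests_if_profile[OF F _ p]) (use T in \<open>auto simp: Phi_def\<close>)
  show "Phi S (Phi S F) = F"
  proof -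
    \<comment> \<open>The second \<open>Phi\<close> intersects \<open>S\<close> with the labels of
      the transformed tree, which are those of \<open>T\<close>, so the same labels are used
      again.\<close>
    have "Phi_tree (S \<inter> labels (?f T)) (?f T) = T" if "T \<in> set F" for T
      using T[OF that] profileD(2)[of k "?f T" T] by simp
    then show ?thesis unfolding Phi_def by (simp add: map_idI)
  qed
  have YP: "Yleaf (Phi S F) = (\<Union>T\<in>set F. Yleaf [?f T])" by (subst Yleaf_forest) (simp add: Phi_def)
  have OP: "Oint (Phi S F) = (\<Union>T\<in>set F. Oint [?f T])" by (subst Oint_forest) (simp add: Phi_def)
  show "Yleaf (Phi S F) = Yleaf F - S \<and> Oint (Phi S F) = Oint F \<union> S" if SY: "S \<subseteq> Yleaf F"
  proof
    have sub: "S \<subseteq> (\<Union>T\<in>set F. labels T)" 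
      by (rule subset_trans[OF SY], subst Yleaf_forest) (rule UN_mono[OF subset_refl YL])
    have "Yleaf (Phi S F) = (\<Union>T\<in>set F. Yleaf [T] - (S \<inter> labels T))"
      unfolding YP using Phi_tree_young(3)[OF good y[OF SY]] by simp
    also have "\<dots> = (\<Union>T\<in>set F. Yleaf [T] - S)" 
      using YL by (intro SUP_cong) auto
    finally show "Yleaf (Phi S F) = Yleaf F - S" unfolding Yleaf_forest[of F] by blast
    have "Oint (Phi S F) = (\<Union>T\<in>set F. Oint [T] \<union> (S \<inter> labels T))"
      unfolding OP using Phi_tree_young(4)[OF good y[OF SY]] by simp
    then show "Oint (Phi S F) = Oint F \<union> S" unfolding Oint_forest[of F] using sub by blast
  qed
  show "Oint (Phi S F) = Oint F - S \<and> Yleaf (Phi S F) = Yleaf F \<union> S" if SO: "S \<subseteq> Oint F"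
  proof
    have sub: "S \<subseteq> (\<Union>T\<in>set F. labels T)" 
      by (rule subset_trans[OF SO], subst Oint_forest) (rule UN_mono[OF subset_refl OL])
    have "Oint (Phi S F) = (\<Union>T\<in>set F. Oint [T] - (S \<inter> labels T))"
      unfolding OP using Phi_tree_old(3)[OF good o[OF SO]] by simp
    also have "\<dots> = (\<Union>T\<in>set F. Oint [T] - S)" 
      using OL by (intro SUP_cong) auto
    finally show "Oint (Phi S F) = Oint F - S" unfolding Oint_forest[of F] by blast
    have "Yleaf (Phi S F) = (\<Union>T\<in>set F. Yleaf [T] \<union> (S \<inter> labels T))"
      unfolding YP using Phi_tree_old(4)[OF good o[OF SO]] by simp
    then show "Yleaf (Phi S F) = Yleaf F \<union> S" unfolding Yleaf_forest[of F] using sub by blast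
  qed
qed

section \<open>Removability expressed by triples\<close>

lemma first_children_leaves_iff:
  assumes "increasing_pruned k t" "\<not> leaf t"
  shows "first_children_leaves k t \<longleftrightarrow> (\<forall>j b. (label t, j, b) \<in> edges t \<longrightarrow> k - 1 \<le> j)"
proof -
  \<comment> \<open>Positions count from 0, so among \<open>k\<close> children only the last, at
    \<open>k - 1\<close>, may have children of its own.\<close>
  have len: "length (children t) = k"
    using assms by (auto simp: increasing_pruned_def locally_increasing_def leaf_def dest: bspec[OF _ self_in_nodes])
  have "(\<forall>j<k - 1. children t ! j = []) \<longleftrightarrow>
      (\<forall>j b. j < k \<and> b \<in> label ` set (children t ! j) \<longrightarrow> k - 1 \<le> j)" (is "?L \<longleftrightarrow> ?R")
  proof
    assume ?L
    then show ?R by (metis empty_iff empty_set image_empty linorder_not_less)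
  next
    assume R: ?R
    show ?L
    proof (intro allI impI)
      fix j assume j: "j < k - 1"
      then have "j < k" by simp
      then have "b \<notin> label ` set (children t ! j)" for b using R j by (meson linorder_not_less)
      then show "children t ! j = []" by (metis equals0I image_is_empty set_empty)
    qed
  qed
  then show ?thesis
    unfolding first_children_leaves_def edges_from_node[OF assms(1) self_in_nodes] len by simp
qed

text \<open>Collecting at \<open>u\<close> leaves at the root exactly the targets up to
  \<open>label u\<close>, so the condition on the transformed tree becomes one on \<open>t\<close>
  itself.\<close>

lemma removable_young_iff:
  assumes t: "increasing_pruned k t"
  shows "young_in t u \<and> leaf u \<and> first_children_leaves k (phi (label u) t) \<longleftrightarrow>
    u \<in> set (grand_children t) \<and> label u \<in> young_leaves (edges t) \<and>
    (\<forall>j b. (label t, j, b) \<in> edges t \<and> b \<le> label u \<longrightarrow> k - 1 \<le> j)"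
proof (cases "u \<in> set (grand_children t)")
  case True
  have un: "u \<in> set (nodes t)" using grand_children_in_nodes[OF self_in_nodes True] .
  obtain i where i: "(label t, i, label u) \<in> edges t"
    using edges_from_node_ex[OF t self_in_nodes] True by blast
  have par: "v = label t" if "(v, l, label u) \<in> edges t" for v l
    using arborescentD(2)[OF arborescent_edges[OF t] that i] .
  have "young_in t u \<longleftrightarrow> (\<exists>w\<in>set (grand_children t). label u < label w)"
    unfolding young_in_def old_in_def using True by (auto simp: not_le)
  also have "\<dots> \<longleftrightarrow> (\<exists>j y. (label t, j, y) \<in> edges t \<and> label u < y)"
    using edges_from_node_ex[OF t self_in_nodes] by (metis (no_types, lifting) imageE imageI)
  finally have y: "young_in t u \<and> leaf u \<longleftrightarrow> label u \<in> young_leaves (edges t)"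
    unfolding young_leaves_def using sink_edges[OF t un] i par by blast
  show ?thesis
  proof (cases "label u \<in> young_leaves (edges t)")
    case yl: True
    note step = phi_young_step[OF t yl]
    note P = profileD[OF step(6)]
    have "\<not> leaf t" using i sink_edges[OF t self_in_nodes] by (auto simp: sink_def)
    then have "\<not> leaf (phi (label u) t)" using P(3) by simp
    then have "first_children_leaves k (phi (label u) t) \<longleftrightarrow>
        (\<forall>j b. (label t, j, b) \<in> collect_edges (label u) (edges t) \<longrightarrow> k - 1 \<le> j)"
      using first_children_leaves_iff[OF step(1)] P(1) step(2) by simp
    also have "\<dots> \<longleftrightarrow> (\<forall>j b. (label t, j, b) \<in> edges t \<and> b \<le> label u \<longrightarrow> k - 1 \<le> j)"
    proof -
      have "sink (edges t) (label u)" using sink_edges[OF t un] y yl by simp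
      moreover have "label t \<noteq> label u" using special_labels(3)[OF t, of "label u"] yl by auto
      ultimately show ?thesis using collect_edges_iff[OF arborescent_edges[OF t] _ i] by (simp add: not_less)
    qed
    finally show ?thesis using y True by blast
  qed (use y in blast)
qed (simp add: young_in_def)

lemma hat_root_iff:
  assumes t: "increasing_pruned k t"
  shows "hat_root k (edges t) (label t) \<longleftrightarrow> \<not> leaf t \<and> \<not> first_children_leaves k t \<and>
    (\<forall>u. young_in t u \<and> leaf u \<longrightarrow> \<not> first_children_leaves k (phi (label u) t))" (is "?L \<longleftrightarrow> ?R")
proof -
  let ?r = "label t" and ?E = "edges t"
  have nl: "\<not> leaf t" if "(?r, j, b) \<in> ?E" for j b
    using that sink_edges[OF t self_in_nodes] by (auto simp: sink_def)
  have fcl: "\<not> leaf t \<and> \<not> first_children_leaves k t \<longleftrightarrow> (\<exists>j b. (?r, j, b) \<in> ?E \<and> j < k - 1)"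
    using first_children_leaves_iff[OF t] nl by (metis linorder_not_less)
  show ?thesis
  proof
    assume ?L
    then obtain j b where b: "(?r, j, b) \<in> ?E" "j < k - 1"
      "\<And>u i. (?r, i, u) \<in> ?E \<Longrightarrow> u \<in> young_leaves ?E \<Longrightarrow> b \<le> u"
      unfolding hat_root_def by blast
    have "\<not> first_children_leaves k (phi (label u) t)" if "young_in t u" "leaf u" for u
    proof
      assume "first_children_leaves k (phi (label u) t)"
      then have u: "u \<in> set (grand_children t)" "label u \<in> young_leaves ?E"
        "\<And>j b. (?r, j, b) \<in> ?E \<Longrightarrow> b \<le> label u \<Longrightarrow> k - 1 \<le> j"
        using removable_young_iff[OF t, of u] that by auto
      obtain i where "(?r, i, label u) \<in> ?E" using edges_from_node_ex[OF t self_in_nodes] u(1) by blast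
      then show False using b u by fastforce
    qed
    then show ?R using fcl b by blast
  next
    assume R: ?R
    \<comment> \<open>Each young leaf that is not removable provides its own target no larger than
      itself at one of the first \<open>k - 1\<close> positions. The least of all such targets lies
      below every one of them.\<close>
    define B where "B = (LEAST b. \<exists>j. (?r, j, b) \<in> ?E \<and> j < k - 1)"
    have ex: "\<exists>b j. (?r, j, b) \<in> ?E \<and> j < k - 1" using R fcl by blast
    then have "\<exists>j. (?r, j, B) \<in> ?E \<and> j < k - 1" unfolding B_def by (rule LeastI_ex)
    then obtain j where j: "(?r, j, B) \<in> ?E" "j < k - 1" by blast
    have "B \<le> u" if u: "(?r, i, u) \<in> ?E" "u \<in> young_leaves ?E" for u i
    proof -
      obtain v where v: "v \<in> set (grand_children t)" "label v = u"
        using edges_from_node_ex[OF t self_in_nodes, of u] u(1) by blast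
      have "v \<in> set (nodes t)" using grand_children_in_nodes[OF self_in_nodes v(1)] .
      then have lf: "leaf v" using sink_edges[OF t] u(2) v(2) by (auto elim: young_leavesE)
      obtain c l m y where c: "(c, l, u) \<in> ?E" "(c, m, y) \<in> ?E" "u < y" using u(2) by (rule young_leavesE)
      have "c = ?r" using arborescentD(2)[OF arborescent_edges[OF t] c(1) u(1)] .
      then obtain w where "w \<in> set (grand_children t)" "label w = y"
        using edges_from_node_ex[OF t self_in_nodes, of y] c(2) by blast
      then have "young_in t v" using v c(3) by (auto simp: young_in_def old_in_def not_le)
      then have "\<not> first_children_leaves k (phi (label v) t)" using R lf by blast
      then obtain j' b where "(?r, j', b) \<in> ?E" "b \<le> u" "j' < k - 1"
        using removable_young_iff[OF t, of v] \<open>young_in t v\<close> lf v u(2) by (auto simp: not_le)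
      moreover from this have "B \<le> b" unfolding B_def by (intro Least_le) blast
      ultimately show ?thesis by simp
    qed
    then show ?L unfolding hat_root_def using j by blast
  qed
qed

lemma removable_root_iff:
  assumes t: "increasing_pruned k t"
  shows "(\<exists>u. x = label u \<and> old_in t u \<and> leaf u \<and> (\<forall>w \<in> set (grand_children t). leaf w \<longrightarrow> w = u) \<and>
     first_children_leaves k t) \<longleftrightarrow> removable_root k (edges t) (label t) x" (is "?L \<longleftrightarrow> ?R")
proof
  let ?r = "label t" and ?E = "edges t"
  note gc = edges_from_node_ex[OF t self_in_nodes]
  have sk: "sink ?E (label w) \<longleftrightarrow> leaf w" if "w \<in> set (grand_children t)" for w
    using sink_edges[OF t grand_children_in_nodes[OF self_in_nodes that]] .
  have nl: "\<not> leaf t" if "(?r, j, b) \<in> ?E" for j b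
    using that sink_edges[OF t self_in_nodes] by (auto simp: sink_def)
  \<comment> \<open>Both directions are proved inside this block so that the facts above serve each
    of them.\<close>
  {
    assume ?L
    then obtain u where u: "x = label u" "u \<in> set (grand_children t)" "leaf u"
      "\<And>w. w \<in> set (grand_children t) \<Longrightarrow> label w \<le> label u"
      "\<And>w. w \<in> set (grand_children t) \<Longrightarrow> leaf w \<Longrightarrow> w = u" "first_children_leaves k t"
      unfolding old_in_def by blast
    obtain i where i: "(?r, i, x) \<in> ?E" using gc[of x] u(1,2) by blast
    have "b \<le> x \<and> (sink ?E b \<longrightarrow> b = x) \<and> k - 1 \<le> j" if e: "(?r, j, b) \<in> ?E" for j b
    proof -
      obtain w where w: "w \<in> set (grand_children t)" "label w = b" using gc[of b] e by blast
      then show ?thesis using u sk[OF w(1)] first_children_leaves_iff[OF t nl[OF e]] e by blast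
    qed
    then show ?R unfolding removable_root_def using i sk[OF u(2)] u(1,3) by blast
  next
    assume R: ?R
    then obtain i where i: "(?r, i, x) \<in> ?E" unfolding removable_root_def by blast
    obtain u where u: "u \<in> set (grand_children t)" "label u = x" using gc[of x] i by blast
    have w: "label w \<le> x \<and> (leaf w \<longrightarrow> w = u)" if gw: "w \<in> set (grand_children t)" for w
    proof -
      obtain j where "(?r, j, label w) \<in> ?E" using gc[of "label w"] gw by blast
      then have "label w \<le> x \<and> (sink ?E (label w) \<longrightarrow> label w = x)"
        using R unfolding removable_root_def by blast
      then show ?thesis using sk[OF gw] u(2)
        nodes_label_inj[OF t grand_children_in_nodes[OF self_in_nodes gw] grand_children_in_nodes[OF self_in_nodes u(1)]]
        by auto
    qed
    have "first_children_leaves k t" using first_children_leaves_iff[OF t nl[OF i]] R unfolding removable_root_def by blast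
    moreover have "leaf u" using sk[OF u(1)] u(2) R unfolding removable_root_def by blast
    ultimately show ?L using u w unfolding old_in_def by blast
  }
qed

lemma hat_rleaf_iff:
  assumes F: "F \<in> forests n k" and ne: "F \<noteq> []"
  shows "F \<in> forests_hat n k \<and> rleaf k F = 0 \<longleftrightarrow>
    hat_root k (edges (last F)) (label (last F)) \<and>
    (\<forall>i < length F. \<forall>x. removable_root k (edges (F ! i)) (label (F ! i)) x \<longrightarrow>
       \<not> (i + 1 < length F \<longrightarrow> x < label (F ! (i + 1))))"
proof -
  note good = forests_increasing_pruned[OF F]
  have gl: "increasing_pruned k (last F)" using good ne by simp
  have gi: "increasing_pruned k (F ! i)" if "i < length F" for i using good that by simp
  have ro: "removable_old k F = {x. \<exists>i<length F. removable_root k (edges (F ! i)) (label (F ! i)) x \<and>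
      (i + 1 < length F \<longrightarrow> x < label (F ! (i + 1)))}"
  proof -
    have "removable_old k F = {x. \<exists>i<length F. (\<exists>u. x = label u \<and> old_in (F ! i) u \<and> leaf u \<and>
       (\<forall>w \<in> set (grand_children (F ! i)). leaf w \<longrightarrow> w = u) \<and> first_children_leaves k (F ! i)) \<and>
      (i + 1 < length F \<longrightarrow> x < label (F ! (i + 1)))}"
      unfolding removable_old_def by blast
    also have "\<dots> = {x. \<exists>i<length F. removable_root k (edges (F ! i)) (label (F ! i)) x \<and>
      (i + 1 < length F \<longrightarrow> x < label (F ! (i + 1)))}"
      using removable_root_iff[OF gi] by (intro Collect_cong) blast
    finally show ?thesis .
  qed
  have "removable_old k F \<subseteq> (\<Union>T\<in>set F. labels T)"
  proof
    fix x assume "x \<in> removable_old k F"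
    then obtain i where i: "i < length F" "removable_root k (edges (F ! i)) (label (F ! i)) x"
      unfolding ro by blast
    then have "x \<in> labels (F ! i)" using edges_labels(2)[OF gi[OF i(1)]] unfolding removable_root_def by blast
    then show "x \<in> (\<Union>T\<in>set F. labels T)" using i(1) nth_mem by blast
  qed
  \<comment> \<open>An infinite set has \<open>card\<close> 0, so \<open>rleaf k F = 0\<close>
    yields emptiness only together with finiteness.\<close>
  then have fo: "finite (removable_old k F)" by (rule finite_subset) simp
  have "removable_young k F \<subseteq> labels (last F)"
    using grand_children_in_nodes[OF self_in_nodes[of "last F"]]
    unfolding removable_young_def young_in_def labels_def by auto
  then have fy: "finite (removable_young k F)" by (rule finite_subset) simp
  have ry: "removable_young k F = {} \<longleftrightarrow>
     (\<forall>u. young_in (last F) u \<and> leaf u \<longrightarrow> \<not> first_children_leaves k (phi (label u) (last F)))"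
    using ne unfolding removable_young_def by blast
  have "F \<in> forests_hat n k \<longleftrightarrow> \<not> leaf (last F) \<and> \<not> first_children_leaves k (last F)"
    using F unfolding forests_hat_def forests_bar_def by blast
  then show ?thesis
    unfolding rleaf_def using fo fy ry hat_root_iff[OF gl] by (auto simp: ro)
qed

text \<open>Every quantity here is determined by the list of profiles; the bound on \<open>n\<close>
  makes the forest nonempty, so that its last tree exists.\<close>

lemma profile_forest_invariants:
  assumes F: "F \<in> forests n k" and G: "G \<in> forests n k" and n: "n \<ge> 1"
    and p: "map (profile k) G = map (profile k) F"
  shows "G \<in> forests_hat n k \<and> rleaf k G = 0 \<longleftrightarrow> F \<in> forests_hat n k \<and> rleaf k F = 0"
    and "Si_star G = Si_star F" and "si G = si F"
    and "lleaf G + card (Oint G) = lleaf F + card (Oint F)"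
proof -
  have ne: "F \<noteq> []" using F n unfolding forests_def by auto
  have len: "length G = length F" using p by (metis length_map)
  have ne': "G \<noteq> []" using ne len by auto
  have nth: "profile k (G ! i) = profile k (F ! i)" if "i < length F" for i
    using p that len by (metis nth_map)
  have last: "profile k (last G) = profile k (last F)"
    using nth ne ne' len by (simp add: last_conv_nth)
  show "G \<in> forests_hat n k \<and> rleaf k G = 0 \<longleftrightarrow> F \<in> forests_hat n k \<and> rleaf k F = 0"
    unfolding hat_rleaf_iff[OF F ne] hat_rleaf_iff[OF G ne'] profileD(5)[OF last] len
    using profileD(1,4)[OF nth] by auto
  have "map (\<lambda>T. (label T, leaf T)) G = map (\<lambda>T. (label T, leaf T)) F"
    using len profileD(1,3)[OF nth] by (intro nth_equalityI) simp_all
  then have "(\<lambda>T. (label T, leaf T)) ` set G = (\<lambda>T. (label T, leaf T)) ` set F"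
    by (metis set_map)
  moreover have "Si H = {x. (x, True) \<in> (\<lambda>T. (label T, leaf T)) ` set H}" for H
    unfolding Si_def by auto
  ultimately have "Si G = Si F" by simp
  then show "Si_star G = Si_star F" unfolding Si_star_def using profileD(1,3)[OF last] by simp
  have "map leaf G = map leaf F" using len profileD(3)[OF nth] by (auto intro: nth_equalityI)
  moreover have "si H = length (filter id (map leaf H))" for H
    unfolding si_def by (simp add: filter_map)
  ultimately show "si G = si F" by metis
  have sum: "lleaf H + card (Oint H) = (\<Sum>T\<leftarrow>H. lleaf [T] + card (old_internals (edges T)))"
    if H: "H \<in> forests n k" for H
  proof -
    note good = forests_increasing_pruned[OF H]
    \<comment> \<open>Equal trees in the list would be counted once in the union but twice in the
      sum; increasing root labels exclude this.\<close>
    have "distinct H" using H unfolding forests_def by (auto simp: strict_sorted_iff distinct_map)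
    have l: "lleaf H = (\<Sum>T\<leftarrow>H. lleaf [T])" unfolding lleaf_def by (induction H) auto
    have "card (Oint H) = (\<Sum>T\<in>set H. card (Oint [T]))"
      unfolding Oint_forest[of H]
    proof (rule card_UN_disjoint)
      show "\<forall>T\<in>set H. finite (Oint [T])"
        using Oint_tree_labels[OF good] finite_subset[OF _ finite_labels] by blast
      show "\<forall>T\<in>set H. \<forall>T'\<in>set H. T \<noteq> T' \<longrightarrow> Oint [T] \<inter> Oint [T'] = {}"
        using Oint_tree_labels[OF good] forests_disjoint[OF H] by blast
    qed simp
    also have "\<dots> = (\<Sum>T\<leftarrow>H. card (Oint [T]))" using \<open>distinct H\<close> by (simp add: sum_list_distinct_conv_sum_set)
    also have "\<dots> = (\<Sum>T\<leftarrow>H. card (old_internals (edges T)))"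
      using Oint_tree[OF good] by (intro arg_cong[where f = sum_list] map_cong) auto
    finally show ?thesis using l by (simp add: sum_list_addf)
  qed
  have "map (\<lambda>T. lleaf [T] + card (old_internals (edges T))) G =
        map (\<lambda>T. lleaf [T] + card (old_internals (edges T))) F"
    using len profileD(6)[OF nth] by (auto intro: nth_equalityI)
  then show "lleaf G + card (Oint G) = lleaf F + card (Oint F)" using sum[OF F] sum[OF G] by simp
qed

text \<open>A singleton is a root, whereas old internal nodes and young leaves are targets of
  triples and hence never roots.\<close>

lemma Si_star_disjoint:
  assumes F: "F \<in> forests n k"
  shows "Si_star F \<inter> Oint F = {}" "Si_star F \<inter> Yleaf F = {}"
proof -
  have "x \<notin> Oint F \<union> Yleaf F" if x: "x \<in> Si_star F" for x
  proof
    obtain T where T: "T \<in> set F" "x = label T" 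
      using x unfolding Si_star_def Si_def by (auto split: if_splits)
    assume "x \<in> Oint F \<union> Yleaf F"
    then obtain T' where T': "T' \<in> set F" "x \<in> Oint [T'] \<union> Yleaf [T']"
      unfolding Oint_forest[of F] Yleaf_forest[of F] by blast
    note g = forests_increasing_pruned[OF F T'(1)]
    have "x \<in> labels T'" using Oint_tree_labels[OF g] Yleaf_tree_labels[OF g] T'(2) by blast
    then have "T = T'" using forests_disjoint[OF F T(1) T'(1) label_in_labels] T(2) by simp
    then show False using special_labels(3)[OF g] T(2) T'(2) Oint_tree[OF g] Yleaf_tree[OF g] by auto
  qed
  then show "Si_star F \<inter> Oint F = {}" "Si_star F \<inter> Yleaf F = {}" by auto
qed

theorem proposition5p6:
  fixes n k :: nat
  assumes "n \<ge> 1" and "k \<ge> 1"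
  shows "bij_betw Theta (X_hat n k) (Y_hat n k) \<and>
         bij_betw Theta' (Y_hat n k) (X_hat n k) \<and>
         (\<forall>p \<in> X_hat n k. Theta' (Theta p) = p) \<and>
         (\<forall>q \<in> Y_hat n k. Theta (Theta' q) = q) \<and>
         (\<forall>F S S\<^sub>1 S\<^sub>2. (F, S) \<in> X_hat n k \<and> S\<^sub>1 = S \<inter> Oint F \<and> S\<^sub>2 = S \<inter> Si_star F \<longrightarrow>
            Theta (F, S) = (Phi S\<^sub>1 F, S\<^sub>2) \<and>
            int (lleaf (Phi S\<^sub>1 F)) - int (si (Phi S\<^sub>1 F)) =
              int (lleaf F) - int (si F) + int (card S\<^sub>1))"
proof -
  have X: "Theta (F, S) \<in> Y_hat n k \<and> Theta' (Theta (F, S)) = (F, S)" if "(F, S) \<in> X_hat n k" for F S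
  proof -
    have hat: "F \<in> forests_hat n k" "rleaf k F = 0" and Y: "Yleaf F = {}" and S: "S \<subseteq> Oint F \<union> Si_star F"
      using that unfolding X_hat_def forests_hat_star_def by auto
    have F: "F \<in> forests n k" using hat unfolding forests_hat_def by simp
    define G where "G = Phi (S \<inter> Oint F) F"
    have "S \<inter> Oint F \<subseteq> Oint F" by simp
    note P = Phi_forest[OF F disjI2[OF this]]
    \<comment> \<open>As \<open>F\<close> has no young leaves, those of the image are exactly the
      released labels; this is how \<open>Theta'\<close> recovers the lost part of
      \<open>S\<close>.\<close>
    have G: "Yleaf G = S \<inter> Oint F" "Phi (S \<inter> Oint F) G = F" using P(3,5) Y unfolding G_def by auto
    note I = profile_forest_invariants[OF F P(1) assms(1) P(2), folded G_def]
    have "Theta (F, S) = (G, S \<inter> Si_star F)" unfolding Theta_def G_def by simp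
    then show ?thesis using I(1,2) hat G S unfolding Y_hat_def Theta'_def by auto
  qed
  have Y: "Theta' (F, S) \<in> X_hat n k \<and> Theta (Theta' (F, S)) = (F, S)" if "(F, S) \<in> Y_hat n k" for F S
  proof -
    have hat: "F \<in> forests_hat n k" "rleaf k F = 0" and S: "S \<subseteq> Si_star F"
      using that unfolding Y_hat_def by auto
    have F: "F \<in> forests n k" using hat unfolding forests_hat_def by simp
    define G where "G = Phi (Yleaf F) F"
    note P = Phi_forest[OF F disjI1[OF subset_refl]]
    have G: "Yleaf G = {}" "Oint G = Oint F \<union> Yleaf F" "Phi (Yleaf F) G = F"
      using P(3,4) unfolding G_def by auto
    note I = profile_forest_invariants[OF F P(1) assms(1) P(2), folded G_def]
    have T: "Theta' (F, S) = (G, S \<union> Yleaf F)" unfolding Theta'_def G_def by simp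
    \<comment> \<open>The union splits again because the labels in \<open>Si_star\<close>, which the
      step preserves, are neither old internal nor young leaves.\<close>
    have "(S \<union> Yleaf F) \<inter> Oint G = Yleaf F" "(S \<union> Yleaf F) \<inter> Si_star G = S"
      using G(2) I(2) S Si_star_disjoint[OF F] by auto
    then have "Theta (G, S \<union> Yleaf F) = (F, S)" unfolding Theta_def using G(3) by simp
    moreover have "(G, S \<union> Yleaf F) \<in> X_hat n k"
      unfolding X_hat_def forests_hat_star_def using I(1,2) hat G S by auto
    ultimately show ?thesis using T by simp
  qed
  have stat: "int (lleaf (Phi (S \<inter> Oint F) F)) - int (si (Phi (S \<inter> Oint F) F)) =
      int (lleaf F) - int (si F) + int (card (S \<inter> Oint F))" if "(F, S) \<in> X_hat n k" for F S
  proof -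
    have F: "F \<in> forests n k" using that unfolding X_hat_def forests_hat_star_def forests_hat_def by simp
    have sub: "S \<inter> Oint F \<subseteq> Oint F" by simp
    note P = Phi_forest[OF F disjI2[OF sub]]
    note I = profile_forest_invariants[OF F P(1) assms(1) P(2)]
    have fin: "finite (Oint F)"
      unfolding Oint_forest[of F]
      using Oint_tree_labels[OF forests_increasing_pruned[OF F]] finite_subset[OF _ finite_labels] by blast
    \<comment> \<open>The old internal nodes lost are exactly the released ones. With
      \<open>si\<close> and the sum of \<open>lleaf\<close> and \<open>card Oint\<close> unchanged,
      the labeled leaves increase by as many.\<close>
    have "card (Oint (Phi (S \<inter> Oint F) F)) + card (S \<inter> Oint F) = card (Oint F)"
      using P(5)[OF sub] card_Diff_subset[OF finite_subset[OF sub fin] sub] card_mono[OF fin sub] by simp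
    then show ?thesis using I(3,4) by simp
  qed
  have inv: "\<forall>p \<in> X_hat n k. Theta' (Theta p) = p" "\<forall>q \<in> Y_hat n k. Theta (Theta' q) = q"
    and img: "Theta ` X_hat n k \<subseteq> Y_hat n k" "Theta' ` Y_hat n k \<subseteq> X_hat n k"
    using X Y by auto
  show ?thesis
  proof (intro conjI)
    show "bij_betw Theta (X_hat n k) (Y_hat n k)" by (rule bij_betw_byWitness[OF inv img])
    show "bij_betw Theta' (Y_hat n k) (X_hat n k)" by (rule bij_betw_byWitness[OF inv(2,1) img(2,1)])
  qed (use inv stat in \<open>auto simp: Theta_def\<close>)
qed

end
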